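(* Let $\mathbb{K}$ be a Hausdorff topological field, $E$ a topological $\mathbb{K}$-vector space, $n,m\in\mathbb{N}$, and $U\subseteq\mathbb{K}^n$ as well as $V\subseteq\mathbb{K}^m$ be locally cartesian subsets. Fix decompositions $n=n_1+\cdots+n_\ell$ and $m=m_1+\cdots+m_k$ with $n_1,\ldots,n_\ell,m_1,\ldots,m_k\in\mathbb{N}$. Let $\alpha\in(\mathbb{N}_0\cup\{\infty\})^\ell$ and $\beta\in(\mathbb{N}_0\cup\{\infty\})^k$. Then $f(x,\cdot)\in C^\beta(V,E)$ for each $f\in C^{(\alpha,\beta)}(U\times V,E)$ and $x\in U$, the map \[ f^\vee\colon U\to C^\beta(V,E),\quad x\mapsto f(x,\cdot) \] is $C^\alpha$, and the mapping \[ \Phi\colon C^{(\alpha,\beta)}(U\times V,E)\to C^\alpha(U,C^\beta(V,E)),\quad f\mapsto f^\vee \] is $\mathbb{K}$-linear and a topological embedding. If $\mathbb{K}$ is metrizable (e.g. if $\mathbb{K}$ is a valued field), then $\Phi$ is an isomorphism of topological $\mathbb{K}$-vector spaces.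
   Context: All topological fields are Hausdorff and non-discrete; all topological vector spaces are Hausdorff. A valued field is a field with an absolute value defining a non-discrete topology. $\mathbb{N}=\{1,2,\ldots\}$, $\mathbb{N}_0=\mathbb{N}\cup\{0\}$. A topological embedding is a homeomorphism onto its image. A subset $U\subseteq\mathbb{K}^n$ is cartesian if $U=U_1\times\cdots\times U_n$ with subsets $U_i\subseteq\mathbb{K}$ without isolated points; it is locally cartesian if every point of $U$ has a relatively open neighbourhood in $U$ which is cartesian. Coordinatewise notion. Let $U=U_1\times\cdots\times U_n\subseteq\mathbb{K}^n$ be cartesian, $f\colon U\to E$ and $\gamma\in\mathbb{N}_0^n$. Put $U^{<\gamma>}:=U_1^{1+\gamma_1}\times\cdots\times U_n^{1+\gamma_n}$, with elements $x=(x^{(1)},\ldots,x^{(n)})$, $x^{(i)}=(x^{(i)}_0,\ldots,x^{(i)}_{\gamma_i})$, and let $U^{>\gamma<}$ be the (dense, open) set of $x\in U^{<\gamma>}$ with $x^{(i)}_j\ne x^{(i)}_k$ for all $i$ and $0\le j<k\le\gamma_i$. Define \[ f^{>\gamma<}(x)=\sum_{j_1=0}^{\gamma_1}\cdots\sum_{j_n=0}^{\gamma_n}\Big(\prod_{i=1}^n\ \prod_{k_i\in\{0,\ldots,\gamma_i\}\setminus\{j_i\}}\frac{1}{x^{(i)}_{j_i}-x^{(i)}_{k_i}}\Big)f(x^{(1)}_{j_1},\ldots,x^{(n)}_{j_n}) \] for $x\in U^{>\gamma<}$ (empty products are $1$). For $\eta\in\mathbb{N}_0^n$, $f$ is $C^\eta$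 if for every $\gamma\in\mathbb{N}_0^n$ with $\gamma\le\eta$ (componentwise) $f^{>\gamma<}$ has a (unique) continuous extension $f^{<\gamma>}\colon U^{<\gamma>}\to E$. If $U$ is only locally cartesian, $f$ is $C^\eta$ if $f|_V$ is $C^\eta$ for each cartesian relatively open $V\subseteq U$. The space $C^\eta(U,E)$ of $C^\eta$-maps carries the initial topology with respect to the maps $f\mapsto(f|_V)^{<\gamma>}\in C(V^{<\gamma>},E)$ (compact-open topology on the target) for all $\gamma\le\eta$ in $\mathbb{N}_0^n$ and cartesian relatively open $V\subseteq U$. Notion relative to a decomposition. Let $n=n_1+\cdots+n_\ell$, $\mathbb{K}^n=\mathbb{K}^{n_1}\times\cdots\times\mathbb{K}^{n_\ell}$, $\alpha\in(\mathbb{N}_0\cup\{\infty\})^\ell$. Let $N_\alpha$ be the set of all $\eta=(\eta_1,\ldots,\eta_\ell)\in\mathbb{N}_0^{n_1}\times\cdots\times\mathbb{N}_0^{n_\ell}=\mathbb{N}_0^n$ with $|\eta_j|\le\alpha_j$ for all $j$, where $|\eta_j|$ is the sum of the components of $\eta_j$. A map $f\colon U\to E$ on a locally cartesian set $U\subseteq\mathbb{K}^n$ is $C^\alpha$ if it is $C^\eta$ (coordinatewise) for all $\eta\in N_\alpha$; $C^\alpha(U,E)=\bigcap_{\eta\in N_\alpha}C^\eta(U,E)$ is given the initial topology with respect to the inclusion maps $C^\alpha(U,E)\to C^\eta(U,E)$, $\eta\in N_\alpha$, making it a topological vector space. In the claim, $C^\alpha$ on $U$ refers to the decomposition $n=n_1+\cdots+n_\ell$,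 $C^\beta$ on $V$ to $m=m_1+\cdots+m_k$, and $C^{(\alpha,\beta)}$ on $U\times V\subseteq\mathbb{K}^{n+m}$ to $n+m=n_1+\cdots+n_\ell+m_1+\cdots+m_k$. *)

theory Defs
  imports "HOL-Analysis.Analysis" "HOL-Library.Function_Algebras"
begin

class topological_field =
  field + t2_space + perfect_space + topological_ab_group_add + topological_semigroup_mult +
  assumes tendsto_inverse_nhds: "a \<noteq> 0 \<Longrightarrow> (inverse \<longlongrightarrow> inverse a) (nhds a)"

text \<open>A topological vector space is given by a scalar multiplication on an ambient type and a
  topology whose underlying set is a linear subspace of that type. The ambient type is needed
  because \<open>C\<^sup>\<beta>(V,E)\<close> will itself serve as a space of values.\<close>

locale topological_vector_space = vector_space smul
  for smul :: "'k::topological_field \<Rightarrow> 'e::ab_group_add \<Rightarrow> 'e" +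
  fixes T :: "'e topology"
  assumes subspace_topspace: "subspace (topspace T)"
    and Hausdorff: "Hausdorff_space T"
    and continuous_add: "continuous_map (prod_topology T T) T (\<lambda>(u, v). u + v)"
    and continuous_scale: "continuous_map (prod_topology euclidean T) T (\<lambda>(c, v). smul c v)"

text \<open>A function on a set \<open>A\<close> with values in a vector space is represented by the total function
  that vanishes outside \<open>A\<close>, so that pointwise operations on the function type are the vector
  space operations.\<close>

definition zero_ext :: "'a set \<Rightarrow> ('a \<Rightarrow> 'e::zero) \<Rightarrow> 'a \<Rightarrow> 'e" where
  "zero_ext A f = (\<lambda>x. if x \<in> A then f x else 0)"

definition fun_scale :: "('k \<Rightarrow> 'e \<Rightarrow> 'e) \<Rightarrow> 'k \<Rightarrow> ('a \<Rightarrow> 'e) \<Rightarrow> ('a \<Rightarrow> 'e)" where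
  "fun_scale smul c f = (\<lambda>x. smul c (f x))"

definition linear_map_between ::
  "('k \<Rightarrow> 'e \<Rightarrow> 'e) \<Rightarrow> 'e::plus set \<Rightarrow> ('k \<Rightarrow> 'f \<Rightarrow> 'f) \<Rightarrow> 'f::plus set \<Rightarrow> ('e \<Rightarrow> 'f) \<Rightarrow> bool" where
  "linear_map_between s1 A s2 B h \<longleftrightarrow>
     h \<in> A \<rightarrow> B \<and>
     (\<forall>u\<in>A. \<forall>v\<in>A. h (u + v) = h u + h v) \<and>
     (\<forall>c. \<forall>u\<in>A. h (s1 c u) = s2 c (h u))"

definition initial_topology ::
  "'a set \<Rightarrow> 'i set \<Rightarrow> ('i \<Rightarrow> 'a \<Rightarrow> 'b) \<Rightarrow> ('i \<Rightarrow> 'b topology) \<Rightarrow> 'a topology" where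
  "initial_topology A I h T =
     topology_generated_by (insert A {{a \<in> A. h i a \<in> W} | i W. i \<in> I \<and> openin (T i) W})"

definition continuous_maps :: "'a topology \<Rightarrow> 'b topology \<Rightarrow> ('a \<Rightarrow> 'b) set" where
  "continuous_maps X Y = {g \<in> extensional (topspace X). continuous_map X Y g}"

definition compact_open_topology :: "'a topology \<Rightarrow> 'b topology \<Rightarrow> ('a \<Rightarrow> 'b) topology" where
  "compact_open_topology X Y =
     topology_generated_by
       {{g \<in> continuous_maps X Y. g ` K \<subseteq> W} | K W. compactin X K \<and> openin Y W}"

text \<open>Points of \<open>K\<^sup>n\<close> are extensional functions on \<open>{..<n}\<close>; coordinates are numbered from 0.\<close>

abbreviation coord_space :: "nat \<Rightarrow> (nat \<Rightarrow> 'k::topological_space) topology" where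
  "coord_space n \<equiv> product_topology (\<lambda>_. euclidean) {..<n}"

text \<open>The cartesian set \<open>U\<^sub>0 \<times> \<dots> \<times> U\<^sub>n\<^sub>-\<^sub>1\<close> is handled through the family of its factors; the set
  itself is \<open>Pi\<^sub>E {..<n} U\<close>.\<close>

definition cartesian_factors :: "nat \<Rightarrow> (nat \<Rightarrow> 'k::topological_space set) \<Rightarrow> bool" where
  "cartesian_factors n U \<longleftrightarrow> (\<forall>i<n. \<forall>t\<in>U i. t islimpt U i)"

definition cartesian_open_in ::
  "nat \<Rightarrow> (nat \<Rightarrow> 'k::topological_space) set \<Rightarrow> (nat \<Rightarrow> 'k set) \<Rightarrow> bool" where
  "cartesian_open_in n U V \<longleftrightarrow>
     cartesian_factors n V \<and> openin (subtopology (coord_space n) U) (Pi\<^sub>E {..<n} V)"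

definition locally_cartesian :: "nat \<Rightarrow> (nat \<Rightarrow> 'k::topological_space) set \<Rightarrow> bool" where
  "locally_cartesian n U \<longleftrightarrow>
     U \<subseteq> topspace (coord_space n) \<and>
     (\<forall>x\<in>U. \<exists>V. cartesian_open_in n U V \<and> x \<in> Pi\<^sub>E {..<n} V)"

text \<open>Multi-indices in \<open>\<nat>\<^sub>0\<^sup>n\<close> are functions of which only the values on \<open>{..<n}\<close> matter. The
  entry \<open>x\<^sup>(\<^sup>i\<^sup>)\<^sub>j\<close> of a point of \<open>U\<^sup><\<^sup>\<gamma>\<^sup>>\<close> is \<open>x (i, j)\<close>.\<close>

definition node_index :: "nat \<Rightarrow> (nat \<Rightarrow> nat) \<Rightarrow> (nat \<times> nat) set" where
  "node_index n \<gamma> = (SIGMA i:{..<n}. {..\<gamma> i})"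

definition node_space ::
  "nat \<Rightarrow> (nat \<Rightarrow> 'k::topological_space set) \<Rightarrow> (nat \<Rightarrow> nat) \<Rightarrow> (nat \<times> nat \<Rightarrow> 'k) topology" where
  "node_space n U \<gamma> = product_topology (\<lambda>(i, j). top_of_set (U i)) (node_index n \<gamma>)"

definition distinct_nodes ::
  "nat \<Rightarrow> (nat \<Rightarrow> 'k::topological_space set) \<Rightarrow> (nat \<Rightarrow> nat) \<Rightarrow> (nat \<times> nat \<Rightarrow> 'k) set" where
  "distinct_nodes n U \<gamma> =
     {x \<in> topspace (node_space n U \<gamma>). \<forall>i<n. \<forall>k\<le>\<gamma> i. \<forall>j<k. x (i, j) \<noteq> x (i, k)}"

definition divided_difference ::
  "('k::field \<Rightarrow> 'e::ab_group_add \<Rightarrow> 'e) \<Rightarrow> nat \<Rightarrow> (nat \<Rightarrow> nat) \<Rightarrow>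
     ((nat \<Rightarrow> 'k) \<Rightarrow> 'e) \<Rightarrow> (nat \<times> nat \<Rightarrow> 'k) \<Rightarrow> 'e" where
  "divided_difference smul n \<gamma> f x =
     (\<Sum>j \<in> (\<Pi>\<^sub>E i\<in>{..<n}. {..\<gamma> i}).
        smul (\<Prod>i<n. \<Prod>k\<in>{..\<gamma> i} - {j i}. 1 / (x (i, j i) - x (i, k)))
              (f (\<lambda>i\<in>{..<n}. x (i, j i))))"

definition is_dd_extension ::
  "('k::topological_field \<Rightarrow> 'e::ab_group_add \<Rightarrow> 'e) \<Rightarrow> 'e topology \<Rightarrow> nat \<Rightarrow> (nat \<Rightarrow> 'k set) \<Rightarrow>
     (nat \<Rightarrow> nat) \<Rightarrow> ((nat \<Rightarrow> 'k) \<Rightarrow> 'e) \<Rightarrow> ((nat \<times> nat \<Rightarrow> 'k) \<Rightarrow> 'e) \<Rightarrow> bool" where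
  "is_dd_extension smul T n U \<gamma> f g \<longleftrightarrow>
     g \<in> continuous_maps (node_space n U \<gamma>) T \<and>
     (\<forall>x \<in> distinct_nodes n U \<gamma>. g x = divided_difference smul n \<gamma> f x)"

definition dd_extension ::
  "('k::topological_field \<Rightarrow> 'e::ab_group_add \<Rightarrow> 'e) \<Rightarrow> 'e topology \<Rightarrow> nat \<Rightarrow> (nat \<Rightarrow> 'k set) \<Rightarrow>
     (nat \<Rightarrow> nat) \<Rightarrow> ((nat \<Rightarrow> 'k) \<Rightarrow> 'e) \<Rightarrow> (nat \<times> nat \<Rightarrow> 'k) \<Rightarrow> 'e" where
  "dd_extension smul T n U \<gamma> f = (THE g. is_dd_extension smul T n U \<gamma> f g)"

definition C_on_cartesian ::
  "('k::topological_field \<Rightarrow> 'e::ab_group_add \<Rightarrow> 'e) \<Rightarrow> 'e topology \<Rightarrow> nat \<Rightarrow> (nat \<Rightarrow> 'k set) \<Rightarrow>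
     (nat \<Rightarrow> nat) \<Rightarrow> ((nat \<Rightarrow> 'k) \<Rightarrow> 'e) \<Rightarrow> bool" where
  "C_on_cartesian smul T n U \<eta> f \<longleftrightarrow>
     (\<forall>\<gamma>. (\<forall>i<n. \<gamma> i \<le> \<eta> i) \<longrightarrow> (\<exists>g. is_dd_extension smul T n U \<gamma> f g))"

definition C_eta ::
  "('k::topological_field \<Rightarrow> 'e::ab_group_add \<Rightarrow> 'e) \<Rightarrow> 'e topology \<Rightarrow> nat \<Rightarrow> (nat \<Rightarrow> 'k) set \<Rightarrow>
     (nat \<Rightarrow> nat) \<Rightarrow> ((nat \<Rightarrow> 'k) \<Rightarrow> 'e) set" where
  "C_eta smul T n U \<eta> =
     {f. (\<forall>x\<in>U. f x \<in> topspace T) \<and> (\<forall>x. x \<notin> U \<longrightarrow> f x = 0) \<and>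
         (\<forall>V. cartesian_open_in n U V \<longrightarrow> C_on_cartesian smul T n V \<eta> f)}"

text \<open>The targets \<open>C(V\<^sup><\<^sup>\<gamma>\<^sup>>, E)\<close> for all \<open>V\<close> and \<open>\<gamma>\<close> live in one common type.\<close>

definition C_eta_topology ::
  "('k::topological_field \<Rightarrow> 'e::ab_group_add \<Rightarrow> 'e) \<Rightarrow> 'e topology \<Rightarrow> nat \<Rightarrow> (nat \<Rightarrow> 'k) set \<Rightarrow>
     (nat \<Rightarrow> nat) \<Rightarrow> ((nat \<Rightarrow> 'k) \<Rightarrow> 'e) topology" where
  "C_eta_topology smul T n U \<eta> =
     initial_topology (C_eta smul T n U \<eta>)
       {(V, \<gamma>). cartesian_open_in n U V \<and> (\<forall>i<n. \<gamma> i \<le> \<eta> i)}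
       (\<lambda>(V, \<gamma>) f. dd_extension smul T n V \<gamma> f)
       (\<lambda>(V, \<gamma>). compact_open_topology (node_space n V \<gamma>) T)"

text \<open>A decomposition \<open>n = n\<^sub>1 + \<dots> + n\<^sub>l\<close> is the list \<open>ns\<close> of its summands, and \<open>n\<close> is
  \<open>sum_list ns\<close>; the blocks consist of consecutive coordinates.\<close>

definition block :: "nat list \<Rightarrow> nat \<Rightarrow> nat set" where
  "block ns j = {sum_list (take j ns)..<sum_list (take (Suc j) ns)}"

definition admissible_indices :: "nat list \<Rightarrow> enat list \<Rightarrow> (nat \<Rightarrow> nat) set" where
  "admissible_indices ns \<alpha> = {\<eta>. \<forall>j<length ns. enat (\<Sum>i\<in>block ns j. \<eta> i) \<le> \<alpha> ! j}"

definition C_alpha ::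
  "('k::topological_field \<Rightarrow> 'e::ab_group_add \<Rightarrow> 'e) \<Rightarrow> 'e topology \<Rightarrow> nat list \<Rightarrow> (nat \<Rightarrow> 'k) set \<Rightarrow>
     enat list \<Rightarrow> ((nat \<Rightarrow> 'k) \<Rightarrow> 'e) set" where
  "C_alpha smul T ns U \<alpha> = (\<Inter>\<eta>\<in>admissible_indices ns \<alpha>. C_eta smul T (sum_list ns) U \<eta>)"

definition C_alpha_topology ::
  "('k::topological_field \<Rightarrow> 'e::ab_group_add \<Rightarrow> 'e) \<Rightarrow> 'e topology \<Rightarrow> nat list \<Rightarrow> (nat \<Rightarrow> 'k) set \<Rightarrow>
     enat list \<Rightarrow> ((nat \<Rightarrow> 'k) \<Rightarrow> 'e) topology" where
  "C_alpha_topology smul T ns U \<alpha> =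
     initial_topology (C_alpha smul T ns U \<alpha>) (admissible_indices ns \<alpha>)
       (\<lambda>\<eta> f. f) (\<lambda>\<eta>. C_eta_topology smul T (sum_list ns) U \<eta>)"

definition join :: "nat \<Rightarrow> nat \<Rightarrow> (nat \<Rightarrow> 'k) \<Rightarrow> (nat \<Rightarrow> 'k) \<Rightarrow> nat \<Rightarrow> 'k" where
  "join n m x y = (\<lambda>i\<in>{..<n + m}. if i < n then x i else y (i - n))"

definition join_product ::
  "nat \<Rightarrow> nat \<Rightarrow> (nat \<Rightarrow> 'k) set \<Rightarrow> (nat \<Rightarrow> 'k) set \<Rightarrow> (nat \<Rightarrow> 'k) set" where
  "join_product n m U V = {join n m x y | x y. x \<in> U \<and> y \<in> V}"

definition slice ::
  "nat \<Rightarrow> nat \<Rightarrow> (nat \<Rightarrow> 'k) set \<Rightarrow> ((nat \<Rightarrow> 'k) \<Rightarrow> 'e::zero) \<Rightarrow> (nat \<Rightarrow> 'k) \<Rightarrow> (nat \<Rightarrow> 'k) \<Rightarrow> 'e" where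
  "slice n m V f x = zero_ext V (\<lambda>y. f (join n m x y))"

definition vee ::
  "nat \<Rightarrow> nat \<Rightarrow> (nat \<Rightarrow> 'k) set \<Rightarrow> (nat \<Rightarrow> 'k) set \<Rightarrow> ((nat \<Rightarrow> 'k) \<Rightarrow> 'e::zero) \<Rightarrow>
     (nat \<Rightarrow> 'k) \<Rightarrow> (nat \<Rightarrow> 'k) \<Rightarrow> 'e" where
  "vee n m U V f = zero_ext U (\<lambda>x. slice n m V f x)"

end

theory Submission
  imports Defs
begin

text \<open>By uniqueness of continuous extensions from the dense set of pairwise distinct nodes,
  \<open>((f\<^sup>\<or>)\<^sup><\<^sup>\<gamma>\<^sup>>(x))\<^sup><\<^sup>\<delta>\<^sup>>(y) = f\<^sup><\<^sup>(\<^sup>\<gamma>\<^sup>,\<^sup>\<delta>\<^sup>)\<^sup>>(x,y)\<close>. Hence \<open>f\<^sup>\<or>\<close> is \<open>C\<^sup>\<alpha>\<close>, and since the compact-open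
  topology on \<open>C(X \<times> Y, E)\<close> has a subbasis given by the compact boxes \<open>K \<times> L\<close>, subbasic sets of the
  two function spaces correspond to each other under \<open>\<Phi>\<close>. Conversely, for
  \<open>h \<in> C\<^sup>\<alpha>(U, C\<^sup>\<beta>(V, E))\<close> the map \<open>(x, y) \<mapsto> (h\<^sup><\<^sup>\<gamma>\<^sup>>(x))\<^sup><\<^sup>\<delta>\<^sup>>(y)\<close> is continuous on \<open>X \<times> L\<close> for compact \<open>L\<close>, hence
  along convergent sequences, which is enough when the field is metrizable.\<close>

section \<open>Generated topologies and compact-open topologies\<close>

text \<open>Two features of the definitions shape the proof. First, \<open>f\<close> has extensions
  only on cartesian sets \<open>P \<times> Q\<close>, whereas the extension of the curried map has
  to yield, for every node tuple \<open>x\<close>, one function on all of \<open>V\<close>, which is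
  merely locally cartesian. That function is therefore assembled point by point in \<open>y\<close>
  from the extensions with \<open>\<delta> = 0\<close>, and only afterwards recognized as a C^beta
  map. Density is always used in one group of variables at a time, the other being fixed. Uniqueness
  of extensions is needed for values in \<open>E\<close> and also for values in C^beta(V,E), so the
  latter space has to be shown Hausdorff. Second, the topology on C^alpha(U, C^beta(V,E)) refers to
  all open subsets of C^beta(V,E), which are known only through a subbasis. Since the compact-open
  topology can be computed from a subbasis of the target, it suffices to consider nested tests: a
  compact \<open>K\<close> is to be mapped into a set that is itself described by a compact
  \<open>L\<close>. Such a nested test is precisely a test of the extension of \<open>f\<close> on
  the box \<open>K \<times> L\<close>.\<close>

lemma generate_topology_on_imp_openin:
  assumes "generate_topology_on \<S> W" "\<And>S. S \<in> \<S> \<Longrightarrow> openin X S"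
  shows "openin X W"
  using assms(1) by (induction rule: generate_topology_on.induct) (use assms(2) in auto)

text \<open>Lets statements about a subbasis of the target be applied to a space such as
  \<open>E\<close>, with all open sets as the subbasis.\<close>

lemma topology_generated_by_openin: "topology_generated_by {W. openin X W} = X"
  unfolding topology_eq openin_topology_generated_by_iff
proof (intro allI iffI)
  show "openin X W" if "generate_topology_on {W. openin X W} W" for W
    using that by (rule generate_topology_on_imp_openin) simp
  show "generate_topology_on {W. openin X W} W" if "openin X W" for W
    using that by (intro generate_topology_on.Basis) simp
qed

lemma topology_generated_by_eqI:
  assumes "\<And>S. S \<in> \<S> \<Longrightarrow> openin (topology_generated_by \<T>) S"
    and "\<And>S. S \<in> \<T> \<Longrightarrow> openin (topology_generated_by \<S>) S"
  shows "topology_generated_by \<S> = topology_generated_by \<T>"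
  unfolding topology_eq
proof (intro allI iffI)
  fix W assume "openin (topology_generated_by \<S>) W"
  then show "openin (topology_generated_by \<T>) W"
    using generate_topology_on_imp_openin[OF openin_topology_generated_by assms(1)] by blast
next
  fix W assume "openin (topology_generated_by \<T>) W"
  then show "openin (topology_generated_by \<S>) W"
    using generate_topology_on_imp_openin[OF openin_topology_generated_by assms(2)] by blast
qed

lemma openin_preimage_generated:
  assumes A: "openin X A" and S: "\<And>S. S \<in> \<S> \<Longrightarrow> openin X {a \<in> A. h a \<in> S}"
    and W: "openin (topology_generated_by \<S>) W"
  shows "openin X {a \<in> A. h a \<in> W}"
  using openin_topology_generated_by[OF W]
proof induction
  case (Int U V)
  have "{a \<in> A. h a \<in> U \<inter> V} = {a \<in> A. h a \<in> U} \<inter> {a \<in> A. h a \<in> V}" by auto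
  then show ?case using Int by auto
next
  case (UN K)
  have "{a \<in> A. h a \<in> \<Union>K} = (\<Union>U\<in>K. {a \<in> A. h a \<in> U})" by auto
  then show ?case using UN by auto
qed (use S in auto)

text \<open>The subspace \<open>K\<close> is compact Hausdorff, hence regular, so every point has a
  closed neighbourhood in \<open>K\<close> that lies in a set with property \<open>P\<close>.
  Finitely many of these cover \<open>K\<close>; they are compact and inherit
  \<open>P\<close>.\<close>

lemma compactin_pieces:
  assumes K: "compactin X K" and X: "Hausdorff_space X"
    and nbhd: "\<And>x. x \<in> K \<Longrightarrow> \<exists>U. openin X U \<and> x \<in> U \<and> P U"
    and mono: "\<And>C U. C \<subseteq> U \<Longrightarrow> P U \<Longrightarrow> P C"
  shows "\<exists>\<C>. finite \<C> \<and> (\<forall>C\<in>\<C>. compactin X C \<and> P C) \<and> \<Union>\<C> = K"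
proof -
  define Y where "Y = subtopology X K"
  have KX: "K \<subseteq> topspace X" using K compactin_subset_topspace by blast
  then have tY: "topspace Y = K" by (auto simp: Y_def)
  have cY: "compact_space Y" using K by (simp add: Y_def compact_space_subtopology)
  have nb: "neighbourhood_base_of (closedin Y) Y"
    unfolding neighbourhood_base_of_closedin
    using compact_Hausdorff_imp_regular_space[OF cY] X by (simp add: Y_def Hausdorff_space_subtopology)
  define \<U> where "\<U> = {N. openin Y N \<and> (\<exists>C. closedin Y C \<and> N \<subseteq> C \<and> P C)}"
  have "K \<subseteq> \<Union>\<U>"
  proof
    fix x assume x: "x \<in> K"
    then obtain U where U: "openin X U" "x \<in> U" "P U" using nbhd by blast
    have "openin Y (U \<inter> K)" using U(1) by (auto simp: Y_def openin_subtopology)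
    then obtain N C where "openin Y N" "closedin Y C" "x \<in> N" "N \<subseteq> C" "C \<subseteq> U \<inter> K"
      using nb x U(2) unfolding neighbourhood_base_of by (metis IntI)
    then show "x \<in> \<Union>\<U>" using mono[of C U] U(3) unfolding \<U>_def by blast
  qed
  moreover have "compactin Y K" using cY tY by (simp add: compact_space_def)
  ultimately obtain \<F> where \<F>: "finite \<F>" "\<F> \<subseteq> \<U>" "K \<subseteq> \<Union>\<F>"
    unfolding compactin_def by (metis (no_types, lifting) \<U>_def mem_Collect_eq)
  then have "\<forall>N\<in>\<F>. \<exists>C. closedin Y C \<and> N \<subseteq> C \<and> P C" by (auto simp: \<U>_def)
  then obtain c where c: "\<And>N. N \<in> \<F> \<Longrightarrow> closedin Y (c N) \<and> N \<subseteq> c N \<and> P (c N)" by metis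
  have "compactin X (c N) \<and> c N \<subseteq> K" if "N \<in> \<F>" for N
    using closedin_compact_space[OF cY] c[OF that] by (auto simp: Y_def compactin_subtopology)
  then have "finite (c ` \<F>) \<and> (\<forall>C\<in>c ` \<F>. compactin X C \<and> P C) \<and> \<Union>(c ` \<F>) = K"
    using \<F> c by blast
  then show ?thesis by blast
qed

text \<open>The compact-open topology on maps into a space needs only the subbasic open sets of that space,
  because compact sets can be cut into small compact pieces.\<close>

lemma openin_compact_open_generated:
  assumes A: "openin M A" and X: "Hausdorff_space X"
    and F: "\<And>a. a \<in> A \<Longrightarrow> continuous_map X (topology_generated_by \<S>) (F a)"
    and sub: "\<And>K S. compactin X K \<Longrightarrow> S \<in> \<S> \<Longrightarrow> openin M {a \<in> A. F a ` K \<subseteq> S}"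
    and W: "openin (topology_generated_by \<S>) W" and K: "compactin X K"
  shows "openin M {a \<in> A. F a ` K \<subseteq> W}"
  using openin_topology_generated_by[OF W] K
proof (induction arbitrary: K)
  case Empty
  then show ?case by (cases "K = {}") (use A in auto)
next
  case (Int U V)
  have "{a \<in> A. F a ` K \<subseteq> U \<inter> V} = {a \<in> A. F a ` K \<subseteq> U} \<inter> {a \<in> A. F a ` K \<subseteq> V}" by auto
  then show ?case using Int by auto
next
  case (UN \<K>)
  show ?case
  proof (subst openin_subopen, intro ballI)
    fix a assume "a \<in> {a \<in> A. F a ` K \<subseteq> \<Union>\<K>}"
    then have a: "a \<in> A" "F a ` K \<subseteq> \<Union>\<K>" by auto
    \<comment> \<open>A compact set mapped into a union need not be mapped into one member. By
      continuity of \<open>F a\<close> small pieces of it are, and the induction hypothesis is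
      applied to each piece, which is why \<open>K\<close> is arbitrary in the induction.\<close>
    let ?P = "\<lambda>U. \<exists>V\<in>\<K>. F a ` U \<subseteq> V"
    have "\<exists>U. openin X U \<and> x \<in> U \<and> ?P U" if x: "x \<in> K" for x
    proof -
      obtain V where V: "V \<in> \<K>" "F a x \<in> V" using a x by blast
      have "openin (topology_generated_by \<S>) V"
        using UN.hyps V by (simp add: openin_topology_generated_by_iff)
      then have "openin X {x \<in> topspace X. F a x \<in> V}"
        using F[OF a(1)] openin_continuous_map_preimage by blast
      moreover have "x \<in> topspace X" using x UN.prems compactin_subset_topspace by blast
      ultimately show ?thesis using V
        by (intro exI[of _ "{x \<in> topspace X. F a x \<in> V}"]) auto
    qed
    moreover have "?P C" if "C \<subseteq> U" "?P U" for C U using that by blast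
    ultimately have "\<exists>\<C>. finite \<C> \<and> (\<forall>C\<in>\<C>. compactin X C \<and> ?P C) \<and> \<Union>\<C> = K"
      by (rule compactin_pieces[OF UN.prems X])
    then obtain \<C> where \<C>: "finite \<C>" "\<forall>C\<in>\<C>. compactin X C \<and> ?P C" "\<Union>\<C> = K" by blast
    then have "\<forall>C\<in>\<C>. ?P C" by blast
    from bchoice[OF this[unfolded Bex_def]] obtain v
      where v: "\<And>C. C \<in> \<C> \<Longrightarrow> v C \<in> \<K> \<and> F a ` C \<subseteq> v C" by blast
    \<comment> \<open>For an empty family of pieces the bare intersection would be the whole type;
      intersecting with \<open>A\<close> settles this case.\<close>
    have "openin M (A \<inter> (\<Inter>C\<in>\<C>. {a \<in> A. F a ` C \<subseteq> v C}))"
    proof (cases "\<C> = {}")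
      case False
      then have "openin M (\<Inter>C\<in>\<C>. {a \<in> A. F a ` C \<subseteq> v C})"
        using \<C> v UN.IH by (intro openin_INT2) auto
      then show ?thesis using A by blast
    qed (use A in auto)
    moreover have "a \<in> A \<inter> (\<Inter>C\<in>\<C>. {a \<in> A. F a ` C \<subseteq> v C})" using a v by auto
    moreover have "A \<inter> (\<Inter>C\<in>\<C>. {a \<in> A. F a ` C \<subseteq> v C}) \<subseteq> {a \<in> A. F a ` K \<subseteq> \<Union>\<K>}"
      using \<C>(3) v by blast
    ultimately show "\<exists>T. openin M T \<and> a \<in> T \<and> T \<subseteq> {a \<in> A. F a ` K \<subseteq> \<Union>\<K>}" by blast
  qed
next
  case (Basis S)
  then show ?case using sub by blast
qed

text \<open>A piece of \<open>K\<close> that lies in some box mapped into \<open>W\<close> can be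
  enlarged to the box of its two projections without leaving \<open>W\<close>. These boxes are
  compact, so finitely many box conditions describe a neighbourhood of \<open>a\<close> inside the
  given set.\<close>

lemma openin_compact_open_boxes:
  fixes X :: "'b topology" and Y :: "'c topology"
  assumes A: "openin M A" and X: "Hausdorff_space X" and Y: "Hausdorff_space Y"
    and F: "\<And>a. a \<in> A \<Longrightarrow> continuous_map (prod_topology X Y) T (F a)"
    and W: "openin T W"
    and box: "\<And>K L. compactin X K \<Longrightarrow> compactin Y L \<Longrightarrow> openin M {a \<in> A. F a ` (K \<times> L) \<subseteq> W}"
    and K: "compactin (prod_topology X Y) K"
  shows "openin M {a \<in> A. F a ` K \<subseteq> W}"
proof (subst openin_subopen, intro ballI)
  fix a assume "a \<in> {a \<in> A. F a ` K \<subseteq> W}"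
  then have a: "a \<in> A" "F a ` K \<subseteq> W" by auto
  define P where "P S \<longleftrightarrow> (\<exists>U V. S \<subseteq> U \<times> V \<and> F a ` (U \<times> V) \<subseteq> W)" for S
  define G where "G = {p \<in> topspace (prod_topology X Y). F a p \<in> W}"
  have G: "openin (prod_topology X Y) G"
    using F[OF a(1)] W openin_continuous_map_preimage unfolding G_def by blast
  have "\<exists>U. openin (prod_topology X Y) U \<and> p \<in> U \<and> P U" if p: "p \<in> K" for p
  proof -
    obtain x y where xy: "p = (x, y)" by fastforce
    have "(x, y) \<in> G" using p K a(2) compactin_subset_topspace unfolding G_def xy by blast
    then obtain U V where UV: "openin X U" "openin Y V" "x \<in> U" "y \<in> V" "U \<times> V \<subseteq> G"
      using G unfolding openin_prod_topology_alt by meson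
    then have "openin (prod_topology X Y) (U \<times> V)" by (simp add: openin_prod_Times_iff)
    moreover have "F a ` (U \<times> V) \<subseteq> W" using UV(5) unfolding G_def by blast
    ultimately show ?thesis using UV xy unfolding P_def by (intro exI[of _ "U \<times> V"]) auto
  qed
  moreover have "Hausdorff_space (prod_topology X Y)" using X Y by (simp add: Hausdorff_space_prod_topology)
  moreover have "P C" if "C \<subseteq> U" "P U" for C U
    using that unfolding P_def by (meson order_trans)
  ultimately have "\<exists>\<C>. finite \<C> \<and> (\<forall>C\<in>\<C>. compactin (prod_topology X Y) C \<and> P C) \<and> \<Union>\<C> = K"
    using compactin_pieces[OF K, of P] by blast
  then obtain \<C> where \<C>: "finite \<C>" "\<forall>C\<in>\<C>. compactin (prod_topology X Y) C \<and> P C" "\<Union>\<C> = K"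
    by blast
  define b where "b C = fst ` C \<times> snd ` C" for C :: "('b \<times> 'c) set"
  have b: "F a ` b C \<subseteq> W" if "C \<in> \<C>" for C
  proof -
    have "P C" using \<C>(2) that by blast
    then obtain U V where "C \<subseteq> U \<times> V" "F a ` (U \<times> V) \<subseteq> W" unfolding P_def by auto
    moreover from this have "b C \<subseteq> U \<times> V" unfolding b_def by auto
    ultimately show ?thesis by blast
  qed
  have op: "openin M {a \<in> A. F a ` b C \<subseteq> W}" if "C \<in> \<C>" for C
  proof -
    have "compactin (prod_topology X Y) C" using \<C> that by blast
    then have "compactin X (fst ` C)" "compactin Y (snd ` C)"
      using image_compactin continuous_map_fst continuous_map_snd by blast+
    then show ?thesis unfolding b_def by (rule box)
  qed
  have "openin M (A \<inter> (\<Inter>C\<in>\<C>. {a \<in> A. F a ` b C \<subseteq> W}))"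
  proof (cases "\<C> = {}")
    case False
    then have "openin M (\<Inter>C\<in>\<C>. {a \<in> A. F a ` b C \<subseteq> W})"
      using \<C> op by (intro openin_INT2) auto
    then show ?thesis using A by blast
  qed (use A in auto)
  moreover have "a \<in> A \<inter> (\<Inter>C\<in>\<C>. {a \<in> A. F a ` b C \<subseteq> W})" using a b by auto
  moreover have "A \<inter> (\<Inter>C\<in>\<C>. {a \<in> A. F a ` b C \<subseteq> W}) \<subseteq> {a \<in> A. F a ` K \<subseteq> W}"
  proof
    fix a' assume a': "a' \<in> A \<inter> (\<Inter>C\<in>\<C>. {a \<in> A. F a ` b C \<subseteq> W})"
    have "F a' p \<in> W" if p: "p \<in> K" for p
    proof -
      obtain C where C: "C \<in> \<C>" "p \<in> C" using p \<C>(3) by blast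
      then have "p \<in> b C" unfolding b_def using subset_fst_snd by blast
      then show ?thesis using C a' by (auto simp: image_subset_iff)
    qed
    then show "a' \<in> {a \<in> A. F a ` K \<subseteq> W}" using a' by auto
  qed
  ultimately show "\<exists>T. openin M T \<and> a \<in> T \<and> T \<subseteq> {a \<in> A. F a ` K \<subseteq> W}"
    by (intro exI conjI)
qed

lemma embedding_map_generated:
  assumes X: "X = topology_generated_by (insert A \<S>)" and top: "topspace X = A"
    and cont: "continuous_map X Y h" and inj: "inj_on h A"
    and S: "\<And>S. S \<in> \<S> \<Longrightarrow> \<exists>T. openin Y T \<and> S = {a \<in> A. h a \<in> T}"
  shows "embedding_map X Y h"
proof -
  have hA: "h ` A \<subseteq> topspace Y" using cont top continuous_map_image_subset_topspace by blast
  have ex: "\<exists>T. openin Y T \<and> W = {a \<in> A. h a \<in> T}" if "openin X W" for W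
    using that unfolding X openin_topology_generated_by_iff
  proof induction
    case (Int U V)
    then obtain T T' where "openin Y T" "U = {a \<in> A. h a \<in> T}" "openin Y T'" "V = {a \<in> A. h a \<in> T'}"
      by blast
    then show ?case by (intro exI[of _ "T \<inter> T'"]) auto
  next
    case (UN K)
    then obtain t where "\<And>U. U \<in> K \<Longrightarrow> openin Y (t U) \<and> U = {a \<in> A. h a \<in> t U}" by metis
    then show ?case by (intro exI[of _ "\<Union>(t ` K)"]) blast
  next
    case (Basis S)
    show ?case
    proof (cases "S = A")
      case True
      then show ?thesis using hA by (intro exI[of _ "topspace Y"]) auto
    qed (use Basis S in auto)
  qed auto
  have "open_map X (subtopology Y (h ` A)) h"
    unfolding open_map_def
  proof (intro allI impI)
    fix W assume "openin X W"
    then obtain T where "openin Y T" "W = {a \<in> A. h a \<in> T}" using ex by blast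
    moreover from this have "h ` W = T \<inter> h ` A" by auto
    ultimately show "openin (subtopology Y (h ` A)) (h ` W)" unfolding openin_subtopology by blast
  qed
  then have "homeomorphic_map X (subtopology Y (h ` A)) h"
    using hA cont inj top
    by (intro bijective_open_imp_homeomorphic_map) (auto simp: continuous_map_in_subtopology)
  then show ?thesis using top by (simp add: embedding_map_def)
qed

text \<open>Sequences suffice to test continuity on a metrizable product, and a convergent sequence in \<open>Y\<close>
  together with its limit is compact.\<close>

lemma continuous_map_uncurry_metrizable:
  assumes X: "metrizable_space X" and Y: "metrizable_space Y"
    and ran: "\<And>x. x \<in> topspace X \<Longrightarrow> continuous_map Y T (F x)"
    and co: "\<And>L W. compactin Y L \<Longrightarrow> openin T W \<Longrightarrow> openin X {x \<in> topspace X. F x ` L \<subseteq> W}"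
  shows "continuous_map (prod_topology X Y) T (\<lambda>(x, y). F x y)"
proof -
  let ?Z = "prod_topology X Y"
  have "metrizable_space ?Z" using X Y by (simp add: metrizable_space_prod_topology)
  then obtain M d where Md: "Metric_space M d" "?Z = Metric_space.mtopology M d"
    unfolding metrizable_space_def by blast
  interpret Metric_space M d by fact
  have topM: "topspace ?Z = M" using Md(2) by simp
  have "openin ?Z {p \<in> topspace ?Z. (case p of (x, y) \<Rightarrow> F x y) \<in> W}" if W: "openin T W" for W
  proof (rule ccontr)
    let ?S = "{p \<in> topspace ?Z. (case p of (x, y) \<Rightarrow> F x y) \<in> W}"
    assume "\<not> ?thesis"
    then obtain p where p: "p \<in> ?S" "\<And>r. r > 0 \<Longrightarrow> \<not> mball p r \<subseteq> ?S"
      unfolding Md(2) openin_mtopology topspace_mtopology by blast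
    have "\<exists>q. q \<in> mball p (inverse (Suc n)) \<and> q \<notin> ?S" for n
      using p(2)[of "inverse (Suc n)"] by (simp add: subset_eq Bex_def)
    then have "\<forall>n. \<exists>q. q \<in> mball p (inverse (Suc n)) \<and> q \<notin> ?S" by blast
    from choice[OF this] obtain q where q: "\<And>n. q n \<in> mball p (inverse (Suc n))" "\<And>n. q n \<notin> ?S"
      by blast
    have qM: "q n \<in> topspace ?Z" "d p (q n) < inverse (Suc n)" for n using q(1)[of n] topM by auto
    have "limitin mtopology q p sequentially"
      unfolding limit_metric_sequentially
    proof (intro conjI allI impI)
      show "p \<in> M" using p topM by auto
      fix e :: real assume "e > 0"
      then obtain N where N: "inverse (Suc N) < e" using reals_Archimedean by blast
      have "d (q n) p < e" if "n \<ge> N" for n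
      proof -
        have "inverse (real (Suc n)) \<le> inverse (Suc N)" using that by (intro le_imp_inverse_le) auto
        then show ?thesis using qM(2)[of n] N commute[of p "q n"] by linarith
      qed
      then show "\<exists>N. \<forall>n\<ge>N. q n \<in> M \<and> d (q n) p < e" using qM topM by auto
    qed
    then have lim: "limitin ?Z q p sequentially" using Md by simp
    obtain x y where xy: "p = (x, y)" by fastforce
    have xyt: "x \<in> topspace X" "y \<in> topspace Y" "F x y \<in> W" using p(1) xy by auto
    have lx: "limitin X (fst \<circ> q) x sequentially" and ly: "limitin Y (snd \<circ> q) y sequentially"
      using lim unfolding xy limitin_pairwise by auto
    have "openin Y {y \<in> topspace Y. F x y \<in> W}"
      using ran[OF xyt(1)] W openin_continuous_map_preimage by blast
    then obtain N1 where N1: "\<And>n. n \<ge> N1 \<Longrightarrow> F x (snd (q n)) \<in> W"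
      using ly xyt unfolding limitin_sequentially by fastforce
    \<comment> \<open>The sequence is cut off at \<open>N1\<close> so that \<open>F x\<close> maps
      all of \<open>L\<close> into \<open>W\<close>. Then \<open>x\<close> lies in the open set
      determined by \<open>L\<close> and \<open>W\<close>, hence so does \<open>fst (q n)\<close>
      for large \<open>n\<close>; as \<open>snd (q n)\<close> is itself in \<open>L\<close>, the bad
      points \<open>q n\<close> would eventually be mapped into \<open>W\<close>.\<close>
    define L where "L = insert y ((\<lambda>n. snd (q n)) ` {N1..})"
    have "snd (q n) \<in> topspace Y" for n using qM(1)[of n] by (auto simp: mem_Times_iff)
    then have "compactin Y L"
      unfolding L_def by (intro compactin_sequence_with_limit[OF ly]) auto
    then have "openin X {x \<in> topspace X. F x ` L \<subseteq> W}" using co W by blast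
    moreover have "x \<in> {x \<in> topspace X. F x ` L \<subseteq> W}" using xyt N1 by (auto simp: L_def)
    ultimately obtain N2 where N2: "\<And>n. n \<ge> N2 \<Longrightarrow> F (fst (q n)) ` L \<subseteq> W"
      using lx unfolding limitin_sequentially by fastforce
    have "F (fst (q (max N1 N2))) (snd (q (max N1 N2))) \<in> W"
      using N2[of "max N1 N2"] by (auto simp: L_def)
    then show False using q(2)[of "max N1 N2"] qM(1)[of "max N1 N2"] by (simp add: case_prod_beta)
  qed
  moreover have "(case p of (x, y) \<Rightarrow> F x y) \<in> topspace T" if "p \<in> topspace ?Z" for p
    using that ran continuous_map_image_subset_topspace by fastforce
  ultimately show ?thesis unfolding continuous_map_def by (auto simp: Pi_iff)
qed

section \<open>Divided differences and the topology of function spaces\<close>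

lemma node_space_alt: "node_space n U \<gamma> = product_topology (\<lambda>p. top_of_set (U (fst p))) (node_index n \<gamma>)"
  by (simp add: node_space_def case_prod_unfold)

lemma topspace_node_space: "topspace (node_space n U \<gamma>) = (\<Pi>\<^sub>E p\<in>node_index n \<gamma>. U (fst p))"
  by (simp add: node_space_alt)

lemma finite_node_index: "finite (node_index n \<gamma>)"
  by (simp add: node_index_def)

lemma mem_node_index [simp]: "(i, j) \<in> node_index n \<gamma> \<longleftrightarrow> i < n \<and> j \<le> \<gamma> i"
  by (auto simp: node_index_def)

lemma Hausdorff_space_euclidean_t2: "Hausdorff_space (euclidean :: 'a::t2_space topology)"
  unfolding Hausdorff_space_def disjnt_def using hausdorff by (simp, blast)

lemma Hausdorff_space_node_space:
  "Hausdorff_space (node_space n U \<gamma> :: (nat \<times> nat \<Rightarrow> 'k::t2_space) topology)"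
  unfolding node_space_alt Hausdorff_space_product_topology
  by (intro disjI2 ballI Hausdorff_space_subtopology Hausdorff_space_euclidean_t2)

lemma metrizable_space_node_space:
  assumes "metrizable_space (euclidean :: 'k::topological_space topology)"
  shows "metrizable_space (node_space n U \<gamma> :: (nat \<times> nat \<Rightarrow> 'k) topology)"
  unfolding node_space_alt metrizable_space_product_topology
  using assms metrizable_space_subtopology
  by (auto intro!: countable_finite finite_subset[OF _ finite_node_index[of n \<gamma>]])

section \<open>Density of pairwise distinct nodes and uniqueness of extensions\<close>

lemma infinite_injective_choice:
  assumes "finite I" "\<And>i. i \<in> I \<Longrightarrow> infinite (A i)"
  shows "\<exists>y. inj_on y I \<and> (\<forall>i\<in>I. y i \<in> A i)"
  using assms
proof (induction I rule: finite_induct)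
  case (insert i I)
  then obtain y where y: "inj_on y I" "\<forall>i\<in>I. y i \<in> A i" by auto
  have "infinite (A i - y ` I)" using insert by (simp add: Diff_infinite_finite)
  then obtain a where a: "a \<in> A i" "a \<notin> y ` I" using infinite_imp_nonempty by blast
  have eq: "(y(i := a)) ` I = y ` I" using insert.hyps by auto
  have "inj_on (y(i := a)) I" using y(1) insert.hyps by (auto simp: inj_on_def)
  then have "inj_on (y(i := a)) (insert i I)" using a insert.hyps eq by simp
  moreover have "\<forall>i'\<in>insert i I. (y(i := a)) i' \<in> A i'" using y a by auto
  ultimately show ?case by blast
qed auto

text \<open>In a T1 space a nonempty relatively open subset of a set without isolated points is
  infinite. The entries of a node tuple can therefore be moved within a basic neighbourhood so that
  all of them become different, even across coordinates.\<close>

lemma closure_of_distinct_nodes: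
  fixes U :: "nat \<Rightarrow> 'k::t1_space set"
  assumes U: "cartesian_factors n U"
  shows "node_space n U \<gamma> closure_of distinct_nodes n U \<gamma> = topspace (node_space n U \<gamma>)"
  unfolding dense_intersects_open
proof (intro allI impI, elim conjE)
  fix T assume T: "openin (node_space n U \<gamma>) T" "T \<noteq> {}"
  let ?I = "node_index n \<gamma>"
  obtain x where "x \<in> T" using T by blast
  then obtain O' where O': "\<And>p. p \<in> ?I \<Longrightarrow> openin (top_of_set (U (fst p))) (O' p)"
      "x \<in> Pi\<^sub>E ?I O'" "Pi\<^sub>E ?I O' \<subseteq> T"
    using T(1) unfolding node_space_alt openin_product_topology_alt by meson
  have "infinite (O' p)" if p: "p \<in> ?I" for p
  proof
    assume fin: "finite (O' p)"
    obtain G where G: "open G" "O' p = U (fst p) \<inter> G"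
      using O'(1)[OF p] unfolding openin_subtopology by (auto simp: Int_commute)
    have "x p \<in> O' p" using O'(2) p by auto
    then have xp: "x p \<in> U (fst p)" "x p \<in> G" using G(2) by auto
    have "fst p < n" using p by (auto simp: node_index_def)
    then have "x p islimpt U (fst p)" using U xp unfolding cartesian_factors_def by blast
    then have "x p islimpt (U (fst p) \<inter> G)"
      using islimpt_Int_eventually[of "x p" "U (fst p)" G] eventually_at_in_open'[OF G(1) xp(2)] by simp
    then show False using islimpt_finite fin G(2) by metis
  qed
  then obtain y where y: "inj_on y ?I" "\<forall>p\<in>?I. y p \<in> O' p"
    using infinite_injective_choice[OF finite_node_index] by blast
  define z where "z = restrict y ?I"
  have zO: "z \<in> Pi\<^sub>E ?I O'" using y by (auto simp: z_def)
  then have zT: "z \<in> T" using O' by blast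
  then have zt: "z \<in> topspace (node_space n U \<gamma>)" using T(1) openin_subset by blast
  have ne: "z (i, j) \<noteq> z (i, k)" if "i < n" "k \<le> \<gamma> i" "j < k" for i j k
  proof -
    have "(i, j) \<in> ?I" "(i, k) \<in> ?I" using that by auto
    then have "z (i, j) = y (i, j)" "z (i, k) = y (i, k)" "y (i, j) = y (i, k) \<longrightarrow> j = k"
      using inj_onD[OF y(1)] by (auto simp: z_def)
    then show ?thesis using that by auto
  qed
  then have "z \<in> distinct_nodes n U \<gamma>" using zt by (auto simp: distinct_nodes_def)
  then show "distinct_nodes n U \<gamma> \<inter> T \<noteq> {}" using zT by blast
qed

lemma distinct_nodes_subset: "distinct_nodes n U \<gamma> \<subseteq> topspace (node_space n U \<gamma>)"
  by (auto simp: distinct_nodes_def)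

text \<open>The transfer principle behind the identities between extensions: they are verified on
  pairwise distinct nodes, where the divided difference formula is available, and hold everywhere by
  density.\<close>

lemma continuous_map_eq_on_distinct_nodes:
  fixes U :: "nat \<Rightarrow> 'k::t1_space set"
  assumes "cartesian_factors n U" "Hausdorff_space T"
    and "continuous_map (node_space n U \<gamma>) T g" "continuous_map (node_space n U \<gamma>) T h"
    and "\<And>x. x \<in> distinct_nodes n U \<gamma> \<Longrightarrow> g x = h x"
    and "x \<in> topspace (node_space n U \<gamma>)"
  shows "g x = h x"
proof (rule forall_in_closure_of_eq[OF _ assms(2,3,4,5)])
  show "x \<in> node_space n U \<gamma> closure_of distinct_nodes n U \<gamma>"
    using assms(6) closure_of_distinct_nodes[OF assms(1)] by simp
qed

lemma is_dd_extension_unique: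
  assumes U: "cartesian_factors n U" and T: "Hausdorff_space T"
    and g: "is_dd_extension smul T n U \<gamma> f g" and h: "is_dd_extension smul T n U \<gamma> f h"
  shows "g = h"
proof -
  let ?X = "node_space n U \<gamma>"
  have g': "continuous_map ?X T g" "g \<in> extensional (topspace ?X)"
    and h': "continuous_map ?X T h" "h \<in> extensional (topspace ?X)"
    using g h by (simp_all add: is_dd_extension_def continuous_maps_def)
  have eq: "g x = h x" if "x \<in> distinct_nodes n U \<gamma>" for x
    using that g h by (simp add: is_dd_extension_def)
  show ?thesis
    by (rule extensionalityI[OF g'(2) h'(2)])
      (rule continuous_map_eq_on_distinct_nodes[OF U T g'(1) h'(1) eq])
qed

text \<open>Gives the definite description in \<open>dd_extension\<close> its meaning; from here on,
  any continuous extension that can be exhibited is the chosen one.\<close>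

lemma dd_extension_eq:
  assumes "cartesian_factors n U" "Hausdorff_space T" "is_dd_extension smul T n U \<gamma> f g"
  shows "dd_extension smul T n U \<gamma> f = g"
  unfolding dd_extension_def
proof (rule the_equality)
  show "is_dd_extension smul T n U \<gamma> f g" by fact
  show "h = g" if "is_dd_extension smul T n U \<gamma> f h" for h
    using assms(1,2) that assms(3) by (rule is_dd_extension_unique)
qed

lemma dd_extensionD:
  assumes "is_dd_extension smul T n U \<gamma> f g"
  shows "continuous_map (node_space n U \<gamma>) T g" "g \<in> extensional (topspace (node_space n U \<gamma>))"
    "g \<in> continuous_maps (node_space n U \<gamma>) T"
    "\<And>x. x \<in> distinct_nodes n U \<gamma> \<Longrightarrow> g x = divided_difference smul n \<gamma> f x"
  using assms by (auto simp: is_dd_extension_def continuous_maps_def)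

lemma is_dd_extension_restrictI:
  assumes "continuous_map (node_space n U \<gamma>) T g"
    and "\<And>x. x \<in> distinct_nodes n U \<gamma> \<Longrightarrow> g x = divided_difference smul n \<gamma> f x"
  shows "is_dd_extension smul T n U \<gamma> f (restrict g (topspace (node_space n U \<gamma>)))"
proof -
  have "continuous_map (node_space n U \<gamma>) T (restrict g (topspace (node_space n U \<gamma>)))"
    using assms(1) by (rule continuous_map_eq) auto
  then show ?thesis
    using assms(2) distinct_nodes_subset[of n U \<gamma>]
    by (auto simp: is_dd_extension_def continuous_maps_def)
qed

section \<open>Admissible multi-indices and subbases for spaces of C^alpha maps\<close>

lemma zero_in_admissible_indices: "(\<lambda>_. 0) \<in> admissible_indices ns \<alpha>"
  by (simp add: admissible_indices_def flip: zero_enat_def)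

lemma block_subset: "block ns j \<subseteq> {..<sum_list ns}"
proof -
  have "sum_list (take (Suc j) ns) \<le> sum_list (take (Suc j) ns @ drop (Suc j) ns)"
    by (simp only: sum_list_append)
  then show ?thesis by (auto simp: block_def)
qed

lemma admissible_indices_mono:
  assumes \<eta>: "\<eta> \<in> admissible_indices ns \<alpha>" and le: "\<And>i. i < sum_list ns \<Longrightarrow> \<gamma> i \<le> \<eta> i"
  shows "\<gamma> \<in> admissible_indices ns \<alpha>"
  unfolding admissible_indices_def
proof (intro CollectI allI impI)
  fix j assume j: "j < length ns"
  have "(\<Sum>i\<in>block ns j. \<gamma> i) \<le> (\<Sum>i\<in>block ns j. \<eta> i)"
    using le block_subset[of ns j] by (intro sum_mono) auto
  then have "enat (\<Sum>i\<in>block ns j. \<gamma> i) \<le> enat (\<Sum>i\<in>block ns j. \<eta> i)" by simp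
  also have "\<dots> \<le> \<alpha> ! j" using \<eta> j by (simp add: admissible_indices_def)
  finally show "enat (\<Sum>i\<in>block ns j. \<gamma> i) \<le> \<alpha> ! j" .
qed

text \<open>Admissible indices form a downward closed set, so the quantifiers over admissible
  \<open>\<eta>\<close> and over \<open>\<gamma> \<le> \<eta>\<close> merge into a single one over
  admissible \<open>\<gamma>\<close>. The conditions on the values of \<open>f\<close> can be read
  off from the index 0, which is always admissible.\<close>

lemma C_alpha_iff:
  "f \<in> C_alpha smul T ns U \<alpha> \<longleftrightarrow>
     (\<forall>x\<in>U. f x \<in> topspace T) \<and> (\<forall>x. x \<notin> U \<longrightarrow> f x = 0) \<and>
     (\<forall>V \<gamma>. cartesian_open_in (sum_list ns) U V \<longrightarrow> \<gamma> \<in> admissible_indices ns \<alpha> \<longrightarrow>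
        (\<exists>g. is_dd_extension smul T (sum_list ns) V \<gamma> f g))"
  (is "?L \<longleftrightarrow> ?R")
proof
  assume L: ?L
  then have "f \<in> C_eta smul T (sum_list ns) U (\<lambda>_. 0)"
    using zero_in_admissible_indices[of ns \<alpha>] unfolding C_alpha_def by blast
  moreover have "\<exists>g. is_dd_extension smul T (sum_list ns) V \<gamma> f g"
    if "cartesian_open_in (sum_list ns) U V" "\<gamma> \<in> admissible_indices ns \<alpha>" for V \<gamma>
  proof -
    have "f \<in> C_eta smul T (sum_list ns) U \<gamma>" using L that(2) unfolding C_alpha_def by blast
    then show ?thesis using that(1) unfolding C_eta_def C_on_cartesian_def by simp
  qed
  ultimately show ?R by (simp add: C_eta_def)
next
  assume R: ?R
  show ?L
    unfolding C_alpha_def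
  proof (intro INT_I)
    fix \<eta> assume \<eta>: "\<eta> \<in> admissible_indices ns \<alpha>"
    have "C_on_cartesian smul T (sum_list ns) V \<eta> f" if "cartesian_open_in (sum_list ns) U V" for V
      unfolding C_on_cartesian_def
      using R that admissible_indices_mono[OF \<eta>] by simp
    then show "f \<in> C_eta smul T (sum_list ns) U \<eta>" using R by (simp add: C_eta_def)
  qed
qed

lemma C_alpha_dd_extension:
  assumes "f \<in> C_alpha smul T ns U \<alpha>" "Hausdorff_space T"
    and "cartesian_open_in (sum_list ns) U V" "\<gamma> \<in> admissible_indices ns \<alpha>"
  shows "is_dd_extension smul T (sum_list ns) V \<gamma> f (dd_extension smul T (sum_list ns) V \<gamma> f)"
proof -
  obtain g where g: "is_dd_extension smul T (sum_list ns) V \<gamma> f g"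
    using assms unfolding C_alpha_iff by blast
  then have "dd_extension smul T (sum_list ns) V \<gamma> f = g"
    using dd_extension_eq assms(2,3) unfolding cartesian_open_in_def by blast
  then show ?thesis using g by simp
qed

lemma topspace_C_alpha_topology [simp]:
  "topspace (C_alpha_topology smul T ns U \<alpha>) = C_alpha smul T ns U \<alpha>"
  unfolding C_alpha_topology_def initial_topology_def topology_generated_by_topspace by blast

text \<open>For \<open>\<gamma> = 0\<close> the space \<open>U\<^sup><\<^sup>\<gamma>\<^sup>>\<close> is \<open>U\<close> itself.\<close>

definition single_nodes :: "nat \<Rightarrow> (nat \<Rightarrow> 'k) \<Rightarrow> nat \<times> nat \<Rightarrow> 'k" where
  "single_nodes n x = (\<lambda>p\<in>node_index n (\<lambda>_. 0). x (fst p))"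

lemma single_nodes_distinct:
  assumes "x \<in> Pi\<^sub>E {..<n} U"
  shows "single_nodes n x \<in> distinct_nodes n U (\<lambda>_. 0)"
proof -
  have "x (fst p) \<in> U (fst p)" if "p \<in> node_index n (\<lambda>_. 0)" for p
  proof -
    have "fst p \<in> {..<n}" using that unfolding node_index_def by (metis SigmaE fst_conv)
    then show ?thesis by (rule PiE_mem[OF assms])
  qed
  then have "single_nodes n x \<in> topspace (node_space n U (\<lambda>_. 0))"
    unfolding topspace_node_space single_nodes_def by (intro restrict_PiE_iff[THEN iffD2] ballI)
  then show ?thesis by (simp add: distinct_nodes_def)
qed

lemma single_nodes_topspace:
  "x \<in> Pi\<^sub>E {..<n} U \<Longrightarrow> single_nodes n x \<in> topspace (node_space n U (\<lambda>_. 0))"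
  using single_nodes_distinct distinct_nodes_subset by blast

text \<open>The sum has a single term, with coefficient 1. Only \<open>smul 1 v = v\<close> is
  assumed, so that the statement also applies directly to \<open>fun_scale smul\<close> and
  function-valued maps.\<close>

lemma divided_difference_single_nodes:
  assumes one: "\<And>v. smul 1 v = v" and x: "x \<in> Pi\<^sub>E {..<n} U"
  shows "divided_difference smul n (\<lambda>_. 0) f (single_nodes n x) = f x"
proof -
  have "(\<Pi>\<^sub>E i\<in>{..<n}. {..0::nat}) = {\<lambda>i\<in>{..<n}. 0}"
    by (auto simp: PiE_def extensional_def fun_eq_iff Pi_iff)
  moreover have "(\<lambda>i\<in>{..<n}. single_nodes n x (i, 0)) = x"
    using x by (auto simp: single_nodes_def fun_eq_iff PiE_def extensional_def)
  then have "(\<lambda>i\<in>{..<n}. single_nodes n x (i, (\<lambda>i\<in>{..<n}. 0) i)) = x"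
    by (simp cong: restrict_cong)
  ultimately show ?thesis by (simp add: divided_difference_def one)
qed

text \<open>Both layers of initial topologies collapse to one subbasis, in which the target sets
  range over any chosen subbasis \<open>\<S>\<close> of \<open>T\<close>. This freedom is what makes
  the case manageable where \<open>T\<close> is itself the topology of a space of differentiable
  maps.\<close>

lemma C_alpha_topology_generated:
  fixes smul :: "'k::topological_field \<Rightarrow> 'e::ab_group_add \<Rightarrow> 'e"
  assumes T: "T = topology_generated_by \<S>" and Haus: "Hausdorff_space T" and n: "n = sum_list ns"
  shows "C_alpha_topology smul T ns U \<alpha> = topology_generated_by (insert (C_alpha smul T ns U \<alpha>)
    {{f \<in> C_alpha smul T ns U \<alpha>. dd_extension smul T n V \<gamma> f ` K \<subseteq> W} | V \<gamma> K W.
       cartesian_open_in n U V \<and> \<gamma> \<in> admissible_indices ns \<alpha> \<and>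
       compactin (node_space n V \<gamma>) K \<and> W \<in> \<S>})"
proof -
  define A where "A = C_alpha smul T ns U \<alpha>"
  let ?\<G> = "{{f \<in> A. dd_extension smul T n V \<gamma> f ` K \<subseteq> W} | V \<gamma> K W.
       cartesian_open_in n U V \<and> \<gamma> \<in> admissible_indices ns \<alpha> \<and>
       compactin (node_space n V \<gamma>) K \<and> W \<in> \<S>}"
  let ?X = "C_alpha_topology smul T ns U \<alpha>"
  let ?Y = "topology_generated_by (insert A ?\<G>)"
  let ?dd = "\<lambda>V \<gamma>. dd_extension smul T n V \<gamma>"
  let ?Gen = "\<lambda>\<eta>. {{f \<in> C_eta smul T n U \<eta>. (case i of (V, \<gamma>) \<Rightarrow> ?dd V \<gamma>) f \<in> W} | i W.
      i \<in> {(V, \<gamma>). cartesian_open_in n U V \<and> (\<forall>i<n. \<gamma> i \<le> \<eta> i)} \<and>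
      openin (case i of (V, \<gamma>) \<Rightarrow> compact_open_topology (node_space n V \<gamma>) T) W}"
  have Ceta: "C_eta_topology smul T n U \<eta> = topology_generated_by (insert (C_eta smul T n U \<eta>) (?Gen \<eta>))" for \<eta>
    unfolding C_eta_topology_def initial_topology_def by (simp add: case_prod_unfold)
  have sub: "A \<subseteq> C_eta smul T n U \<eta>" if "\<eta> \<in> admissible_indices ns \<alpha>" for \<eta>
    using that unfolding A_def C_alpha_def n by blast
  have ddA: "?dd V \<gamma> f \<in> continuous_maps (node_space n V \<gamma>) T"
    if "f \<in> A" "cartesian_open_in n U V" "\<gamma> \<in> admissible_indices ns \<alpha>" for f V \<gamma>
    using C_alpha_dd_extension[of f smul T ns U \<alpha> V \<gamma>] that Haus dd_extensionD(3) unfolding A_def n by blast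
  have YA: "openin ?Y A" by (rule topology_generated_by_Basis) simp
  \<comment> \<open>Two reductions: first to the subbasic sets of the compact-open topology, then
    from an arbitrary open target set to members of \<open>\<S>\<close>.\<close>
  have co: "openin ?Y {f \<in> A. ?dd V \<gamma> f \<in> W}"
    if V: "cartesian_open_in n U V" and \<gamma>: "\<gamma> \<in> admissible_indices ns \<alpha>"
      and W: "openin (compact_open_topology (node_space n V \<gamma>) T) W" for V \<gamma> W
  proof (rule openin_preimage_generated[OF YA _ W[unfolded compact_open_topology_def]])
    fix S assume "S \<in> {{g \<in> continuous_maps (node_space n V \<gamma>) T. g ` K \<subseteq> W} |K W.
        compactin (node_space n V \<gamma>) K \<and> openin T W}"
    then obtain K W' where S: "S = {g \<in> continuous_maps (node_space n V \<gamma>) T. g ` K \<subseteq> W'}"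
      and K: "compactin (node_space n V \<gamma>) K" and W': "openin T W'" by blast
    have "{f \<in> A. ?dd V \<gamma> f \<in> S} = {f \<in> A. ?dd V \<gamma> f ` K \<subseteq> W'}"
      using ddA[OF _ V \<gamma>] unfolding S by auto
    moreover have "openin ?Y {f \<in> A. ?dd V \<gamma> f ` K \<subseteq> W'}"
    proof (rule openin_compact_open_generated[OF YA Hausdorff_space_node_space _ _ W'[unfolded T] K])
      show "continuous_map (node_space n V \<gamma>) (topology_generated_by \<S>) (?dd V \<gamma> f)" if "f \<in> A" for f
        using ddA[OF that V \<gamma>] T by (simp add: continuous_maps_def)
      show "openin ?Y {f \<in> A. ?dd V \<gamma> f ` K' \<subseteq> S'}"
        if "compactin (node_space n V \<gamma>) K'" "S' \<in> \<S>" for K' S'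
        using that V \<gamma> by (intro topology_generated_by_Basis insertI2 CollectI exI conjI) (rule refl)
    qed
    ultimately show "openin ?Y {f \<in> A. ?dd V \<gamma> f \<in> S}" by simp
  qed
  have inY: "openin ?Y {f \<in> A. f \<in> W}"
    if \<eta>: "\<eta> \<in> admissible_indices ns \<alpha>" and W: "openin (C_eta_topology smul T n U \<eta>) W" for \<eta> W
  proof (rule openin_preimage_generated[OF YA _ W[unfolded Ceta]])
    fix S assume "S \<in> insert (C_eta smul T n U \<eta>) (?Gen \<eta>)"
    then consider "S = C_eta smul T n U \<eta>"
      | V \<gamma> W' where "S = {f \<in> C_eta smul T n U \<eta>. ?dd V \<gamma> f \<in> W'}" "cartesian_open_in n U V"
        "\<forall>i<n. \<gamma> i \<le> \<eta> i" "openin (compact_open_topology (node_space n V \<gamma>) T) W'"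
      by auto
    then show "openin ?Y {f \<in> A. f \<in> S}"
    proof cases
      case 1
      then have "{f \<in> A. f \<in> S} = A" using sub[OF \<eta>] by auto
      then show ?thesis using YA by simp
    next
      case 2
      have "{f \<in> A. f \<in> S} = {f \<in> A. ?dd V \<gamma> f \<in> W'}" using sub[OF \<eta>] 2(1) by auto
      moreover have "\<gamma> \<in> admissible_indices ns \<alpha>" using admissible_indices_mono[OF \<eta>] 2(3) n by simp
      ultimately show ?thesis using co[OF 2(2) _ 2(4)] by simp
    qed
  qed
  have XY: "?X = topology_generated_by (insert A {{f \<in> A. f \<in> W} | \<eta> W.
      \<eta> \<in> admissible_indices ns \<alpha> \<and> openin (C_eta_topology smul T n U \<eta>) W})"
    unfolding C_alpha_topology_def initial_topology_def A_def n ..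
  have inX: "openin ?X S" if SG: "S \<in> ?\<G>" for S
  proof -
    obtain V \<gamma> K W where S: "S = {f \<in> A. ?dd V \<gamma> f ` K \<subseteq> W}" and V: "cartesian_open_in n U V"
      and \<gamma>: "\<gamma> \<in> admissible_indices ns \<alpha>" and K: "compactin (node_space n V \<gamma>) K" and W: "W \<in> \<S>"
      using SG by blast
    let ?C = "{g \<in> continuous_maps (node_space n V \<gamma>) T. g ` K \<subseteq> W}"
    have "openin T W" unfolding T using W by (rule topology_generated_by_Basis)
    then have C: "openin (compact_open_topology (node_space n V \<gamma>) T) ?C"
      unfolding compact_open_topology_def using K
      by (intro topology_generated_by_Basis CollectI exI conjI) (rule refl)
    \<comment> \<open>The index \<open>\<gamma>\<close> is itself admissible, so the C^eta space
      with \<open>\<eta> = \<gamma>\<close> already provides this test.\<close>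
    let ?S = "{f \<in> C_eta smul T n U \<gamma>. ?dd V \<gamma> f \<in> ?C}"
    have "?S \<in> ?Gen \<gamma>" using V C by (intro CollectI exI[of _ "(V, \<gamma>)"] exI[of _ ?C]) simp
    then have "openin (C_eta_topology smul T n U \<gamma>) ?S"
      unfolding Ceta by (intro topology_generated_by_Basis insertI2)
    then have "openin ?X {f \<in> A. f \<in> ?S}"
      unfolding XY using \<gamma> by (intro topology_generated_by_Basis insertI2 CollectI exI conjI) (rule refl)
    moreover have "{f \<in> A. f \<in> ?S} = S" using sub[OF \<gamma>] ddA[OF _ V \<gamma>] unfolding S by auto
    ultimately show ?thesis by simp
  qed
  have XA: "openin ?X A" unfolding XY by (rule topology_generated_by_Basis) simp
  have "?X = ?Y"
    unfolding XY
  proof (rule topology_generated_by_eqI, unfold XY[symmetric])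
    fix S assume "S \<in> insert A {{f \<in> A. f \<in> W} | \<eta> W.
      \<eta> \<in> admissible_indices ns \<alpha> \<and> openin (C_eta_topology smul T n U \<eta>) W}"
    then show "openin ?Y S" using inY YA by blast
  next
    fix S assume "S \<in> insert A ?\<G>"
    then show "openin ?X S" using inX XA by (elim insertE) simp_all
  qed
  then show ?thesis unfolding A_def .
qed

text \<open>Evaluation at a point \<open>y\<close> is continuous, because it amounts to testing the
  extension with \<open>\<gamma> = 0\<close> on the compact set consisting of the single node tuple
  of \<open>y\<close>. Evaluations separate maps, as all of them vanish off
  \<open>U\<close>.\<close>

lemma Hausdorff_space_C_alpha_topology:
  fixes smul :: "'k::topological_field \<Rightarrow> 'e::ab_group_add \<Rightarrow> 'e"
  assumes T: "Hausdorff_space T" and one: "\<And>v. smul 1 v = v"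
    and U: "locally_cartesian (sum_list ns) U"
  shows "Hausdorff_space (C_alpha_topology smul T ns U \<alpha>)"
  unfolding Hausdorff_space_def topspace_C_alpha_topology
proof (intro allI impI, elim conjE)
  let ?A = "C_alpha smul T ns U \<alpha>" and ?n = "sum_list ns"
  fix f g assume f: "f \<in> ?A" and g: "g \<in> ?A" and "f \<noteq> g"
  then obtain y where y: "f y \<noteq> g y" by auto
  have zero: "f y = 0" "g y = 0" if "y \<notin> U" using f g that unfolding C_alpha_iff by auto
  have "y \<in> U" using zero y by metis
  then obtain V where V: "cartesian_open_in ?n U V" "y \<in> Pi\<^sub>E {..<?n} V"
    using U unfolding locally_cartesian_def by blast
  let ?y = "single_nodes ?n y" and ?dd = "dd_extension smul T ?n V (\<lambda>_. 0)"
  have dd: "?dd h ?y = h y" if "h \<in> ?A" for h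
    using dd_extensionD(4)[OF C_alpha_dd_extension[OF that T V(1) zero_in_admissible_indices]
        single_nodes_distinct[OF V(2)]]
      divided_difference_single_nodes[of smul, OF one V(2)] by simp
  have op: "openin (C_alpha_topology smul T ns U \<alpha>) {h \<in> ?A. h y \<in> W}" if W: "openin T W" for W
  proof -
    have "compactin (node_space ?n V (\<lambda>_. 0)) {?y}" using single_nodes_topspace[OF V(2)] by simp
    then have "openin (C_alpha_topology smul T ns U \<alpha>) {h \<in> ?A. ?dd h ` {?y} \<subseteq> W}"
      unfolding C_alpha_topology_generated[OF topology_generated_by_openin[symmetric] T refl]
      using W V(1) zero_in_admissible_indices
      by (intro topology_generated_by_Basis insertI2 CollectI exI conjI) (rule refl, auto)
    moreover have "{h \<in> ?A. ?dd h ` {?y} \<subseteq> W} = {h \<in> ?A. h y \<in> W}" using dd by auto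
    ultimately show ?thesis by simp
  qed
  have "f y \<in> topspace T" "g y \<in> topspace T" using f g \<open>y \<in> U\<close> unfolding C_alpha_iff by auto
  then obtain W W' where W: "openin T W" "openin T W'" "f y \<in> W" "g y \<in> W'" "disjnt W W'"
    using T y unfolding Hausdorff_space_def by meson
  let ?S = "\<lambda>W. {h \<in> ?A. h y \<in> W}"
  have "disjnt (?S W) (?S W')" using W(5) by (auto simp: disjnt_iff)
  then show "\<exists>S S'. openin (C_alpha_topology smul T ns U \<alpha>) S \<and>
      openin (C_alpha_topology smul T ns U \<alpha>) S' \<and> f \<in> S \<and> g \<in> S' \<and> disjnt S S'"
    using W op[OF W(1)] op[OF W(2)] f g by (intro exI[of _ "?S W"] exI[of _ "?S W'"]) simp
qed

section \<open>Products of cartesian sets\<close>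

text \<open>By the tube lemma a jointly continuous map is continuous into the compact-open topology
  when curried. This half of the exponential law holds without any metrizability.\<close>

lemma openin_tube:
  assumes F: "continuous_map (prod_topology X Y) T F" and L: "compactin Y L" and W: "openin T W"
  shows "openin X {x \<in> topspace X. \<forall>y\<in>L. F (x, y) \<in> W}"
proof (subst openin_subopen, intro ballI)
  fix x assume "x \<in> {x \<in> topspace X. \<forall>y\<in>L. F (x, y) \<in> W}"
  then have x: "x \<in> topspace X" "\<And>y. y \<in> L \<Longrightarrow> F (x, y) \<in> W" by auto
  define G where "G = {p \<in> topspace (prod_topology X Y). F p \<in> W}"
  have G: "openin (prod_topology X Y) G"
    unfolding G_def using F W by (rule openin_continuous_map_preimage)
  have "L \<subseteq> topspace Y" using L compactin_subset_topspace by blast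
  then have "{x} \<times> L \<subseteq> G" using x by (auto simp: G_def)
  then obtain S S' where S: "openin X S" "x \<in> S" "L \<subseteq> S'" "S \<times> S' \<subseteq> G"
    using tube_lemma_right[OF G L x(1)] by blast
  have "S \<subseteq> {x \<in> topspace X. \<forall>y\<in>L. F (x, y) \<in> W}"
  proof
    fix x' assume x': "x' \<in> S"
    have "(x', y) \<in> G" if "y \<in> L" for y using S x' that by blast
    then show "x' \<in> {x \<in> topspace X. \<forall>y\<in>L. F (x, y) \<in> W}"
      using openin_subset[OF S(1)] x' by (auto simp: G_def)
  qed
  then show "\<exists>S. openin X S \<and> x \<in> S \<and> S \<subseteq> {x \<in> topspace X. \<forall>y\<in>L. F (x, y) \<in> W}"
    using S by blast
qed

lemma restrict_join:
  assumes "x \<in> extensional {..<n}"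
  shows "restrict (join n m x y) {..<n} = x"
  using assms by (auto simp: join_def fun_eq_iff extensional_def)

lemma shift_join:
  assumes "y \<in> extensional {..<m}"
  shows "(\<lambda>i\<in>{..<m}. join n m x y (n + i)) = y"
  using assms by (auto simp: join_def fun_eq_iff extensional_def)

lemma join_split:
  assumes "z \<in> extensional {..<n + m}"
  shows "join n m (restrict z {..<n}) (\<lambda>i\<in>{..<m}. z (n + i)) = z"
  using assms by (auto simp: join_def fun_eq_iff extensional_def)

text \<open>Factors and multi-indices are total functions, in contrast to the extensional points
  handled by \<open>join\<close>. Without a restriction every family is literally the join of itself
  and its shift.\<close>

definition join_family :: "nat \<Rightarrow> (nat \<Rightarrow> 'a) \<Rightarrow> (nat \<Rightarrow> 'a) \<Rightarrow> nat \<Rightarrow> 'a" where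
  "join_family n a b = (\<lambda>i. if i < n then a i else b (i - n))"

lemma join_family_simps [simp]:
  "i < n \<Longrightarrow> join_family n a b i = a i" "join_family n a b (n + i) = b i"
  by (simp_all add: join_family_def)

lemma join_family_split: "join_family n a (\<lambda>i. a (n + i)) = a"
  by (simp add: join_family_def fun_eq_iff)

lemma less_add_cases:
  fixes i n m :: nat
  assumes "i < n + m"
  obtains "i < n" | i' where "i' < m" "i = n + i'"
proof (cases "i < n")
  case False
  then show thesis using assms by (intro that(2)[of "i - n"]) auto
qed (rule that(1))

lemma join_in_PiE:
  assumes "x \<in> Pi\<^sub>E {..<n} U" "y \<in> Pi\<^sub>E {..<m} V"
  shows "join n m x y \<in> Pi\<^sub>E {..<n + m} (join_family n U V)"
proof (rule PiE_I)
  fix i assume "i \<in> {..<n + m}"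
  then have "i < n + m" by simp
  then show "join n m x y i \<in> join_family n U V i"
  proof (cases rule: less_add_cases)
    case 1
    then show ?thesis using PiE_mem[OF assms(1), of i] by (simp add: join_def)
  next
    case (2 i')
    then show ?thesis using PiE_mem[OF assms(2), of i'] by (simp add: join_def)
  qed
qed (simp add: join_def)

lemma split_PiE:
  assumes z: "z \<in> Pi\<^sub>E {..<n + m} (join_family n U V)"
  shows "restrict z {..<n} \<in> Pi\<^sub>E {..<n} U" "(\<lambda>i\<in>{..<m}. z (n + i)) \<in> Pi\<^sub>E {..<m} V"
proof -
  have "z i \<in> U i" if "i < n" for i using PiE_mem[OF z, of i] that by simp
  then show "restrict z {..<n} \<in> Pi\<^sub>E {..<n} U" by (simp add: restrict_PiE_iff)
  have "z (n + i) \<in> V i" if "i < m" for i using PiE_mem[OF z, of "n + i"] that by simp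
  then show "(\<lambda>i\<in>{..<m}. z (n + i)) \<in> Pi\<^sub>E {..<m} V" by (simp add: restrict_PiE_iff)
qed

lemma join_productI: "x \<in> A \<Longrightarrow> y \<in> B \<Longrightarrow> join n m x y \<in> join_product n m A B"
  by (auto simp: join_product_def)

lemma join_productE:
  assumes "z \<in> join_product n m A B"
  obtains x y where "z = join n m x y" "x \<in> A" "y \<in> B"
  using assms by (auto simp: join_product_def)

lemma join_product_PiE:
  "join_product n m (Pi\<^sub>E {..<n} U) (Pi\<^sub>E {..<m} V) = Pi\<^sub>E {..<n + m} (join_family n U V)"
proof (intro equalityI subsetI)
  fix z assume "z \<in> join_product n m (Pi\<^sub>E {..<n} U) (Pi\<^sub>E {..<m} V)"
  then show "z \<in> Pi\<^sub>E {..<n + m} (join_family n U V)"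
    by (rule join_productE) (simp only: join_in_PiE)
next
  fix z assume z: "z \<in> Pi\<^sub>E {..<n + m} (join_family n U V)"
  then have "z = join n m (restrict z {..<n}) (\<lambda>i\<in>{..<m}. z (n + i))"
    by (simp add: join_split PiE_def)
  then show "z \<in> join_product n m (Pi\<^sub>E {..<n} U) (Pi\<^sub>E {..<m} V)"
    using join_productI[OF split_PiE[OF z]] by metis
qed

lemma topspace_coord_space: "topspace (coord_space n) = extensional {..<n}"
  by (simp add: PiE_UNIV_domain PiE_def)

lemma continuous_map_join_left:
  assumes "y \<in> extensional {..<m}"
  shows "continuous_map (coord_space n) (coord_space (n + m)) (\<lambda>x. join n m x y)"
  unfolding continuous_map_componentwise
proof (intro conjI ballI)
  show "(\<lambda>x. join n m x y) ` topspace (coord_space n) \<subseteq> extensional {..<n + m}"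
    by (auto simp: join_def)
  fix i assume "i \<in> {..<n + m}"
  then have "i < n + m" by simp
  then show "continuous_map (coord_space n) euclidean (\<lambda>x. join n m x y i)"
    by (cases rule: less_add_cases) (auto simp: join_def intro!: continuous_map_product_projection)
qed

lemma continuous_map_join_right:
  assumes "x \<in> extensional {..<n}"
  shows "continuous_map (coord_space m) (coord_space (n + m)) (\<lambda>y. join n m x y)"
  unfolding continuous_map_componentwise
proof (intro conjI ballI)
  show "(\<lambda>y. join n m x y) ` topspace (coord_space m) \<subseteq> extensional {..<n + m}"
    by (auto simp: join_def)
  fix i assume "i \<in> {..<n + m}"
  then have "i < n + m" by simp
  then show "continuous_map (coord_space m) euclidean (\<lambda>y. join n m x y i)"
    by (cases rule: less_add_cases) (auto simp: join_def intro!: continuous_map_product_projection)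
qed

lemma continuous_map_restrict_coord: "continuous_map (coord_space (n + m)) (coord_space n) (\<lambda>z. restrict z {..<n})"
  unfolding continuous_map_componentwise by (auto intro!: continuous_map_product_projection)

lemma continuous_map_shift_coord:
  "continuous_map (coord_space (n + m)) (coord_space m) (\<lambda>z. \<lambda>i\<in>{..<m}. z (n + i))"
  unfolding continuous_map_componentwise by (auto intro!: continuous_map_product_projection)

lemma cartesian_open_in_subset: "cartesian_open_in n U V \<Longrightarrow> Pi\<^sub>E {..<n} V \<subseteq> U"
  unfolding cartesian_open_in_def using openin_subset by fastforce

lemma cartesian_open_in_join:
  assumes U: "cartesian_open_in n A U" and V: "cartesian_open_in m B V"
    and A: "A \<subseteq> topspace (coord_space n)" and B: "B \<subseteq> topspace (coord_space m)"
  shows "cartesian_open_in (n + m) (join_product n m A B) (join_family n U V)"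
proof -
  obtain S where S: "openin (coord_space n) S" "Pi\<^sub>E {..<n} U = S \<inter> A"
    using U unfolding cartesian_open_in_def openin_subtopology by blast
  obtain S' where S': "openin (coord_space m) S'" "Pi\<^sub>E {..<m} V = S' \<inter> B"
    using V unfolding cartesian_open_in_def openin_subtopology by blast
  define T where "T = {z \<in> topspace (coord_space (n + m)). restrict z {..<n} \<in> S} \<inter>
    {z \<in> topspace (coord_space (n + m)). (\<lambda>i\<in>{..<m}. z (n + i)) \<in> S'}"
  have T: "openin (coord_space (n + m)) T"
    unfolding T_def
    using openin_continuous_map_preimage[OF continuous_map_restrict_coord S(1)]
      openin_continuous_map_preimage[OF continuous_map_shift_coord S'(1)] by (rule openin_Int)
  have "Pi\<^sub>E {..<n + m} (join_family n U V) = T \<inter> join_product n m A B"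
    unfolding join_product_PiE[symmetric]
  proof (intro equalityI subsetI)
    fix z assume "z \<in> join_product n m (Pi\<^sub>E {..<n} U) (Pi\<^sub>E {..<m} V)"
    then obtain x y where z: "z = join n m x y" and xy: "x \<in> S \<inter> A" "y \<in> S' \<inter> B"
      unfolding S S' by (rule join_productE)
    then have ext: "x \<in> extensional {..<n}" "y \<in> extensional {..<m}"
      using A B unfolding topspace_coord_space by auto
    have "z \<in> extensional {..<n + m}" unfolding z by (simp add: join_def)
    then have "z \<in> T" unfolding T_def topspace_coord_space
      using xy restrict_join[OF ext(1)] shift_join[OF ext(2)] by (simp add: z)
    moreover have "z \<in> join_product n m A B" unfolding z using xy by (intro join_productI) auto
    ultimately show "z \<in> T \<inter> join_product n m A B" by blast
  next
    fix z assume z': "z \<in> T \<inter> join_product n m A B"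
    then obtain x y where z: "z = join n m x y" and xy: "x \<in> A" "y \<in> B"
      by (blast elim: join_productE)
    then have ext: "x \<in> extensional {..<n}" "y \<in> extensional {..<m}"
      using A B unfolding topspace_coord_space by auto
    have "x \<in> S" "y \<in> S'"
      using z' restrict_join[OF ext(1)] shift_join[OF ext(2)] by (simp_all add: T_def z)
    then show "z \<in> join_product n m (Pi\<^sub>E {..<n} U) (Pi\<^sub>E {..<m} V)"
      unfolding S S' z using xy by (intro join_productI) auto
  qed
  moreover have "cartesian_factors (n + m) (join_family n U V)"
    unfolding cartesian_factors_def
  proof (intro allI impI)
    fix i assume "i < n + m"
    then show "\<forall>t\<in>join_family n U V i. t islimpt join_family n U V i"
      by (cases rule: less_add_cases)
        (use U V in \<open>auto simp: cartesian_open_in_def cartesian_factors_def\<close>)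
  qed
  ultimately show ?thesis
    unfolding cartesian_open_in_def openin_subtopology using T by blast
qed

text \<open>Fixing a base point \<open>y0\<close> in the second group of coordinates shows the first
  product of factors to be the trace on \<open>A\<close> of an open set, namely the preimage of
  \<open>S\<close> under \<open>x \<mapsto> join n m x y0\<close>; the second product is treated
  likewise. Nonemptiness supplies the base point: an empty product would reveal nothing about its
  other factors.\<close>

lemma cartesian_open_in_split:
  assumes W: "cartesian_open_in (n + m) (join_product n m A B) W" and ne: "Pi\<^sub>E {..<n + m} W \<noteq> {}"
    and A: "A \<subseteq> topspace (coord_space n)" and B: "B \<subseteq> topspace (coord_space m)"
  shows "cartesian_open_in n A W" "cartesian_open_in m B (\<lambda>i. W (n + i))"
proof -
  let ?V = "\<lambda>i. W (n + i)"
  obtain S where S: "openin (coord_space (n + m)) S" "Pi\<^sub>E {..<n + m} W = S \<inter> join_product n m A B"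
    using W unfolding cartesian_open_in_def openin_subtopology by blast
  have eq: "Pi\<^sub>E {..<n + m} W = join_product n m (Pi\<^sub>E {..<n} W) (Pi\<^sub>E {..<m} ?V)"
    unfolding join_product_PiE join_family_split ..
  obtain x0 y0 where xy0: "x0 \<in> Pi\<^sub>E {..<n} W" "y0 \<in> Pi\<^sub>E {..<m} ?V"
    using ne unfolding eq by (metis ex_in_conv join_productE)
  then have ext0: "x0 \<in> extensional {..<n}" "y0 \<in> extensional {..<m}" by (auto simp: PiE_def)
  have AB: "x \<in> A \<and> y \<in> B \<and> join n m x y \<in> S" if "x \<in> Pi\<^sub>E {..<n} W" "y \<in> Pi\<^sub>E {..<m} ?V" for x y
  proof -
    have "join n m x y \<in> S \<inter> join_product n m A B"
      using that unfolding S(2)[symmetric] eq by (intro join_productI)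
    then obtain x' y' where "join n m x y = join n m x' y'" "x' \<in> A" "y' \<in> B" "join n m x y \<in> S"
      by (metis IntE join_productE)
    moreover from this have "x' \<in> extensional {..<n}" "y' \<in> extensional {..<m}"
      using A B unfolding topspace_coord_space by auto
    moreover have "x \<in> extensional {..<n}" "y \<in> extensional {..<m}"
      using that by (auto simp: PiE_def)
    ultimately show ?thesis by (metis restrict_join shift_join)
  qed
  have mem: "x \<in> Pi\<^sub>E {..<n} W \<and> y \<in> Pi\<^sub>E {..<m} ?V" if "x \<in> A" "y \<in> B" "join n m x y \<in> S" for x y
  proof -
    have "join n m x y \<in> Pi\<^sub>E {..<n + m} (join_family n W ?V)"
      unfolding join_family_split S(2) using that join_productI by (intro IntI)
    moreover have "x \<in> extensional {..<n}" "y \<in> extensional {..<m}"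
      using A B that unfolding topspace_coord_space by auto
    ultimately show ?thesis using split_PiE by (metis restrict_join shift_join)
  qed
  have "Pi\<^sub>E {..<n} W = {x \<in> topspace (coord_space n). join n m x y0 \<in> S} \<inter> A"
    using AB[OF _ xy0(2)] mem[of _ y0] AB[OF xy0] A by blast
  moreover have "openin (coord_space n) {x \<in> topspace (coord_space n). join n m x y0 \<in> S}"
    by (rule openin_continuous_map_preimage[OF continuous_map_join_left[OF ext0(2)] S(1)])
  ultimately have 1: "openin (subtopology (coord_space n) A) (Pi\<^sub>E {..<n} W)"
    unfolding openin_subtopology by blast
  have "Pi\<^sub>E {..<m} ?V = {y \<in> topspace (coord_space m). join n m x0 y \<in> S} \<inter> B"
    using AB[OF xy0(1)] mem[of x0] AB[OF xy0] B by blast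
  moreover have "openin (coord_space m) {y \<in> topspace (coord_space m). join n m x0 y \<in> S}"
    by (rule openin_continuous_map_preimage[OF continuous_map_join_right[OF ext0(1)] S(1)])
  ultimately have 2: "openin (subtopology (coord_space m) B) (Pi\<^sub>E {..<m} ?V)"
    unfolding openin_subtopology by blast
  have "cartesian_factors n W" "cartesian_factors m ?V"
    using W unfolding cartesian_open_in_def cartesian_factors_def by simp_all
  then show "cartesian_open_in n A W" "cartesian_open_in m B ?V"
    using 1 2 unfolding cartesian_open_in_def by blast+
qed

section \<open>Multi-indices and node tuples on a product\<close>

lemma block_append:
  shows "j < length ns \<Longrightarrow> block (ns @ ms) j = block ns j"
    and "block (ns @ ms) (length ns + j) = (+) (sum_list ns) ` block ms j"
proof -
  show "block (ns @ ms) j = block ns j" if "j < length ns" using that by (simp add: block_def)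
  have "Suc (length ns + j) - length ns = Suc j" by simp
  then show "block (ns @ ms) (length ns + j) = (+) (sum_list ns) ` block ms j"
    by (simp add: block_def image_add_atLeastLessThan add.commute)
qed

text \<open>No block straddles the boundary between \<open>ns\<close> and \<open>ms\<close>, so the
  bounds on the block sums decouple. Equal lengths of \<open>\<alpha>\<close> and \<open>ns\<close>
  make the entries of the appended lists line up.\<close>

lemma admissible_indices_append:
  assumes "length \<alpha> = length ns"
  shows "join_family (sum_list ns) \<gamma> \<delta> \<in> admissible_indices (ns @ ms) (\<alpha> @ \<beta>) \<longleftrightarrow>
    \<gamma> \<in> admissible_indices ns \<alpha> \<and> \<delta> \<in> admissible_indices ms \<beta>"
proof -
  let ?\<epsilon> = "join_family (sum_list ns) \<gamma> \<delta>"
  define P where "P j \<longleftrightarrow> enat (\<Sum>i\<in>block (ns @ ms) j. ?\<epsilon> i) \<le> (\<alpha> @ \<beta>) ! j" for j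
  have 1: "P j \<longleftrightarrow> enat (\<Sum>i\<in>block ns j. \<gamma> i) \<le> \<alpha> ! j" if j: "j < length ns" for j
  proof -
    have "(\<Sum>i\<in>block ns j. ?\<epsilon> i) = (\<Sum>i\<in>block ns j. \<gamma> i)"
      using block_subset[of ns j] by (intro sum.cong) auto
    then show ?thesis using j assms by (simp add: P_def block_append(1) nth_append)
  qed
  have 2: "P (length ns + j) \<longleftrightarrow> enat (\<Sum>i\<in>block ms j. \<delta> i) \<le> \<beta> ! j" for j
    using assms by (simp add: P_def block_append(2) nth_append sum.reindex)
  have "(\<forall>j<length ns + length ms. P j) \<longleftrightarrow> (\<forall>j<length ns. P j) \<and> (\<forall>j<length ms. P (length ns + j))"
    by (auto elim: less_add_cases)
  then show ?thesis
    using 1 2 by (simp add: admissible_indices_def flip: P_def)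
qed

text \<open>With inverse given by \<open>left_nodes\<close> and \<open>right_nodes\<close>, this is
  the homeomorphism from the product of the two node spaces onto the node space of the product set.
  It regroups coordinates only; the numbering of the entries within a coordinate is kept.\<close>

definition join_nodes ::
  "nat \<Rightarrow> nat \<Rightarrow> (nat \<Rightarrow> nat) \<Rightarrow> (nat \<Rightarrow> nat) \<Rightarrow> (nat \<times> nat \<Rightarrow> 'k) \<Rightarrow> (nat \<times> nat \<Rightarrow> 'k) \<Rightarrow> nat \<times> nat \<Rightarrow> 'k"
where
  "join_nodes n m \<gamma> \<delta> x y = (\<lambda>p\<in>node_index (n + m) (join_family n \<gamma> \<delta>).
     if fst p < n then x p else y (fst p - n, snd p))"

definition left_nodes :: "nat \<Rightarrow> (nat \<Rightarrow> nat) \<Rightarrow> (nat \<times> nat \<Rightarrow> 'k) \<Rightarrow> nat \<times> nat \<Rightarrow> 'k" where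
  "left_nodes n \<gamma> z = restrict z (node_index n \<gamma>)"

definition right_nodes :: "nat \<Rightarrow> nat \<Rightarrow> (nat \<Rightarrow> nat) \<Rightarrow> (nat \<times> nat \<Rightarrow> 'k) \<Rightarrow> nat \<times> nat \<Rightarrow> 'k" where
  "right_nodes n m \<delta> z = (\<lambda>p\<in>node_index m \<delta>. z (n + fst p, snd p))"

lemma node_index_join_cases:
  assumes "p \<in> node_index (n + m) (join_family n \<gamma> \<delta>)"
  obtains (left) "fst p < n" "p \<in> node_index n \<gamma>"
  | (right) i j where "p = (n + i, j)" "(i, j) \<in> node_index m \<delta>"
proof -
  obtain i j where p: "p = (i, j)" by fastforce
  then have ij: "i < n + m" "j \<le> join_family n \<gamma> \<delta> i" using assms by auto
  from ij(1) show thesis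
  proof (cases rule: less_add_cases)
    case 1
    then show ?thesis using ij p by (intro left) auto
  next
    case (2 i')
    then show ?thesis using ij p by (intro right[of i' j]) auto
  qed
qed

lemma join_nodes_simps [simp]:
  "i < n \<Longrightarrow> j \<le> \<gamma> i \<Longrightarrow> join_nodes n m \<gamma> \<delta> x y (i, j) = x (i, j)"
  "i < m \<Longrightarrow> j \<le> \<delta> i \<Longrightarrow> join_nodes n m \<gamma> \<delta> x y (n + i, j) = y (i, j)"
  by (simp_all add: join_nodes_def)

lemma join_nodes_split:
  assumes "z \<in> extensional (node_index (n + m) (join_family n \<gamma> \<delta>))"
  shows "join_nodes n m \<gamma> \<delta> (left_nodes n \<gamma> z) (right_nodes n m \<delta> z) = z"
proof (rule extensionalityI[OF _ assms])
  show "join_nodes n m \<gamma> \<delta> (left_nodes n \<gamma> z) (right_nodes n m \<delta> z)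
      \<in> extensional (node_index (n + m) (join_family n \<gamma> \<delta>))"
    by (simp add: join_nodes_def)
  fix p assume "p \<in> node_index (n + m) (join_family n \<gamma> \<delta>)"
  then show "join_nodes n m \<gamma> \<delta> (left_nodes n \<gamma> z) (right_nodes n m \<delta> z) p = z p"
  proof (cases rule: node_index_join_cases)
    case left
    then show ?thesis by (cases p) (simp add: left_nodes_def)
  next
    case (right i j)
    then show ?thesis by (simp add: right_nodes_def)
  qed
qed

lemma continuous_map_join_nodes:
  fixes U V :: "nat \<Rightarrow> 'k::topological_space set"
  shows "continuous_map (prod_topology (node_space n U \<gamma>) (node_space m V \<delta>))
    (node_space (n + m) (join_family n U V) (join_family n \<gamma> \<delta>)) (\<lambda>(x, y). join_nodes n m \<gamma> \<delta> x y)"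
  unfolding node_space_alt[of "n + m"] continuous_map_componentwise
proof (intro conjI ballI)
  let ?X = "node_space n U \<gamma>" and ?Y = "node_space m V \<delta>"
  show "(\<lambda>(x, y). join_nodes n m \<gamma> \<delta> x y) ` topspace (prod_topology ?X ?Y)
      \<subseteq> extensional (node_index (n + m) (join_family n \<gamma> \<delta>))"
    by (auto simp: join_nodes_def)
  fix p assume "p \<in> node_index (n + m) (join_family n \<gamma> \<delta>)"
  then show "continuous_map (prod_topology ?X ?Y) (top_of_set (join_family n U V (fst p)))
      (\<lambda>q. (case q of (x, y) \<Rightarrow> join_nodes n m \<gamma> \<delta> x y) p)"
  proof (cases rule: node_index_join_cases)
    case left
    have "continuous_map ?X (top_of_set (U (fst p))) (\<lambda>x. x p)"
      unfolding node_space_alt using left(2) by (rule continuous_map_product_projection)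
    from continuous_map_compose[OF continuous_map_fst this]
    have "continuous_map (prod_topology ?X ?Y) (top_of_set (U (fst p))) (\<lambda>q. fst q p)"
      by (simp add: o_def)
    moreover have "(\<lambda>q :: (nat \<times> nat \<Rightarrow> 'k) \<times> (nat \<times> nat \<Rightarrow> 'k). (case q of (x, y) \<Rightarrow> join_nodes n m \<gamma> \<delta> x y) p) = (\<lambda>q. fst q p)"
      using left by (cases p) (auto simp: fun_eq_iff)
    ultimately show ?thesis using left(1) by (simp only: join_family_simps)
  next
    case (right i j)
    have "continuous_map ?Y (top_of_set (V (fst (i, j)))) (\<lambda>x. x (i, j))"
      unfolding node_space_alt using right(2) by (rule continuous_map_product_projection)
    from continuous_map_compose[OF continuous_map_snd this]
    have "continuous_map (prod_topology ?X ?Y) (top_of_set (V i)) (\<lambda>q. snd q (i, j))"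
      by (simp add: o_def)
    moreover have "(\<lambda>q :: (nat \<times> nat \<Rightarrow> 'k) \<times> (nat \<times> nat \<Rightarrow> 'k). (case q of (x, y) \<Rightarrow> join_nodes n m \<gamma> \<delta> x y) p) = (\<lambda>q. snd q (i, j))"
      using right by (auto simp: fun_eq_iff)
    ultimately show ?thesis unfolding right(1) by (simp only: join_family_simps fst_conv)
  qed
qed

lemma join_nodes_topspace:
  fixes U V :: "nat \<Rightarrow> 'k::topological_space set"
  assumes "x \<in> topspace (node_space n U \<gamma>)" "y \<in> topspace (node_space m V \<delta>)"
  shows "join_nodes n m \<gamma> \<delta> x y \<in>
    topspace (node_space (n + m) (join_family n U V) (join_family n \<gamma> \<delta>))"
  using continuous_map_image_subset_topspace[OF continuous_map_join_nodes[of n U \<gamma> m V \<delta>]] assms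
  by (auto simp: image_subset_iff)

lemma continuous_map_left_nodes:
  fixes U V :: "nat \<Rightarrow> 'k::topological_space set"
  shows "continuous_map (node_space (n + m) (join_family n U V) (join_family n \<gamma> \<delta>))
    (node_space n U \<gamma>) (left_nodes n \<gamma>)"
  unfolding node_space_alt[of n] continuous_map_componentwise
proof (intro conjI ballI)
  let ?Z = "node_space (n + m) (join_family n U V) (join_family n \<gamma> \<delta>)"
  show "left_nodes n \<gamma> ` topspace ?Z \<subseteq> extensional (node_index n \<gamma>)" by (auto simp: left_nodes_def)
  fix p assume p: "p \<in> node_index n \<gamma>"
  then have p': "fst p < n" "p \<in> node_index (n + m) (join_family n \<gamma> \<delta>)"
    by (cases p; simp)+
  have "continuous_map ?Z (top_of_set (join_family n U V (fst p))) (\<lambda>z. z p)"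
    unfolding node_space_alt using p'(2) by (rule continuous_map_product_projection)
  then show "continuous_map ?Z (top_of_set (U (fst p))) (\<lambda>z. left_nodes n \<gamma> z p)"
    using p p'(1) by (simp add: left_nodes_def)
qed

lemma continuous_map_right_nodes:
  fixes U V :: "nat \<Rightarrow> 'k::topological_space set"
  shows "continuous_map (node_space (n + m) (join_family n U V) (join_family n \<gamma> \<delta>))
    (node_space m V \<delta>) (right_nodes n m \<delta>)"
  unfolding node_space_alt[of m] continuous_map_componentwise
proof (intro conjI ballI)
  let ?Z = "node_space (n + m) (join_family n U V) (join_family n \<gamma> \<delta>)"
  show "right_nodes n m \<delta> ` topspace ?Z \<subseteq> extensional (node_index m \<delta>)" by (auto simp: right_nodes_def)
  fix p assume p: "p \<in> node_index m \<delta>"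
  then have p': "(n + fst p, snd p) \<in> node_index (n + m) (join_family n \<gamma> \<delta>)"
    by (cases p) simp
  have "continuous_map ?Z (top_of_set (join_family n U V (fst (n + fst p, snd p)))) (\<lambda>z. z (n + fst p, snd p))"
    unfolding node_space_alt using p' by (rule continuous_map_product_projection)
  then show "continuous_map ?Z (top_of_set (V (fst p))) (\<lambda>z. right_nodes n m \<delta> z p)"
    using p by (simp add: right_nodes_def)
qed

lemma split_nodes_topspace:
  fixes U V :: "nat \<Rightarrow> 'k::topological_space set"
  assumes "z \<in> topspace (node_space (n + m) (join_family n U V) (join_family n \<gamma> \<delta>))"
  shows "left_nodes n \<gamma> z \<in> topspace (node_space n U \<gamma>)" "right_nodes n m \<delta> z \<in> topspace (node_space m V \<delta>)"
  using assms continuous_map_image_subset_topspace[OF continuous_map_left_nodes[of n m U V \<gamma> \<delta>]]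
    continuous_map_image_subset_topspace[OF continuous_map_right_nodes[of n m U V \<gamma> \<delta>]]
  by (simp_all add: image_subset_iff)

text \<open>Entries are compared only within one coordinate, so the conditions on \<open>x\<close>
  and on \<open>y\<close> do not interact.\<close>

lemma join_nodes_distinct:
  fixes U V :: "nat \<Rightarrow> 'k::topological_space set"
  assumes x: "x \<in> distinct_nodes n U \<gamma>" and y: "y \<in> distinct_nodes m V \<delta>"
  shows "join_nodes n m \<gamma> \<delta> x y \<in> distinct_nodes (n + m) (join_family n U V) (join_family n \<gamma> \<delta>)"
  unfolding distinct_nodes_def
proof (intro CollectI conjI allI impI)
  show "join_nodes n m \<gamma> \<delta> x y \<in> topspace (node_space (n + m) (join_family n U V) (join_family n \<gamma> \<delta>))"
    using x y distinct_nodes_subset by (blast intro: join_nodes_topspace)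
  fix i k j assume i: "i < n + m" and k: "k \<le> join_family n \<gamma> \<delta> i" and j: "j < k"
  from i show "join_nodes n m \<gamma> \<delta> x y (i, j) \<noteq> join_nodes n m \<gamma> \<delta> x y (i, k)"
  proof (cases rule: less_add_cases)
    case 1
    then show ?thesis using x k j by (simp add: distinct_nodes_def)
  next
    case (2 i')
    then show ?thesis using y k j by (simp add: distinct_nodes_def)
  qed
qed

lemma split_nodes_distinct:
  fixes U V :: "nat \<Rightarrow> 'k::topological_space set"
  assumes z: "z \<in> distinct_nodes (n + m) (join_family n U V) (join_family n \<gamma> \<delta>)"
  shows "left_nodes n \<gamma> z \<in> distinct_nodes n U \<gamma>" "right_nodes n m \<delta> z \<in> distinct_nodes m V \<delta>"
proof -
  have zt: "z \<in> topspace (node_space (n + m) (join_family n U V) (join_family n \<gamma> \<delta>))"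
    using z distinct_nodes_subset by blast
  have ne: "z (i, j) \<noteq> z (i, k)" if "i < n + m" "k \<le> join_family n \<gamma> \<delta> i" "j < k" for i j k
    using z that unfolding distinct_nodes_def by blast
  have "z (i, j) \<noteq> z (i, k)" if "i < n" "k \<le> \<gamma> i" "j < k" for i j k
    using ne[of i k j] that by simp
  then show "left_nodes n \<gamma> z \<in> distinct_nodes n U \<gamma>"
    using split_nodes_topspace(1)[OF zt] by (simp add: distinct_nodes_def left_nodes_def)
  have "z (n + i, j) \<noteq> z (n + i, k)" if "i < m" "k \<le> \<delta> i" "j < k" for i j k
    using ne[of "n + i" k j] that by simp
  then show "right_nodes n m \<delta> z \<in> distinct_nodes m V \<delta>"
    using split_nodes_topspace(2)[OF zt] by (simp add: distinct_nodes_def right_nodes_def)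
qed

section \<open>Iterated divided differences\<close>

lemma prod_lessThan_add: "(\<Prod>i<n + m. f i) = (\<Prod>i<n. f i) * (\<Prod>i<m. f (n + i))"
  for f :: "nat \<Rightarrow> 'a::comm_monoid_mult"
  by (induction m) (simp_all add: mult.assoc)

lemma bij_betw_join:
  "bij_betw (\<lambda>(k, j). join n m j k) (Pi\<^sub>E {..<m} B \<times> Pi\<^sub>E {..<n} A) (Pi\<^sub>E {..<n + m} (join_family n A B))"
proof (rule bij_betw_byWitness[where f' = "\<lambda>z. (\<lambda>i\<in>{..<m}. z (n + i), restrict z {..<n})"])
  show "\<forall>a\<in>Pi\<^sub>E {..<m} B \<times> Pi\<^sub>E {..<n} A.
       (\<lambda>i\<in>{..<m}. (case a of (k, j) \<Rightarrow> join n m j k) (n + i),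
        restrict (case a of (k, j) \<Rightarrow> join n m j k) {..<n}) = a"
    by (auto simp: restrict_join shift_join PiE_def)
  show "\<forall>a'\<in>Pi\<^sub>E {..<n + m} (join_family n A B).
       (case (\<lambda>i\<in>{..<m}. a' (n + i), restrict a' {..<n}) of (k, j) \<Rightarrow> join n m j k) = a'"
    by (auto simp: join_split PiE_def)
  show "(\<lambda>(k, j). join n m j k) ` (Pi\<^sub>E {..<m} B \<times> Pi\<^sub>E {..<n} A) \<subseteq> Pi\<^sub>E {..<n + m} (join_family n A B)"
    by (intro image_subsetI, elim SigmaE) (simp only: prod.case join_in_PiE)
  show "(\<lambda>z. (\<lambda>i\<in>{..<m}. z (n + i), restrict z {..<n})) ` Pi\<^sub>E {..<n + m} (join_family n A B)
      \<subseteq> Pi\<^sub>E {..<m} B \<times> Pi\<^sub>E {..<n} A"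
    by (intro image_subsetI SigmaI split_PiE)
qed

lemma divided_difference_cong:
  assumes "\<And>j. j \<in> (\<Pi>\<^sub>E i\<in>{..<n}. {..\<gamma> i}) \<Longrightarrow> f (\<lambda>i\<in>{..<n}. x (i, j i)) = g (\<lambda>i\<in>{..<n}. x (i, j i))"
  shows "divided_difference smul n \<gamma> f x = divided_difference smul n \<gamma> g x"
  unfolding divided_difference_def using assms by (intro sum.cong refl) simp

text \<open>A divided difference on a cartesian set evaluates the function only at points of that
  set. Together with \<open>divided_difference_cong\<close> this permits changing the function
  elsewhere.\<close>

lemma select_node:
  assumes x: "x \<in> topspace (node_space n U \<gamma>)" and j: "j \<in> (\<Pi>\<^sub>E i\<in>{..<n}. {..\<gamma> i})"
  shows "(\<lambda>i\<in>{..<n}. x (i, j i)) \<in> Pi\<^sub>E {..<n} U"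
proof -
  have "x (i, j i) \<in> U i" if "i < n" for i
  proof -
    have "j i \<le> \<gamma> i" using PiE_mem[OF j, of i] that by simp
    then have "(i, j i) \<in> node_index n \<gamma>" using that by simp
    then show ?thesis using PiE_mem[OF x[unfolded topspace_node_space]] by fastforce
  qed
  then show ?thesis by (simp add: restrict_PiE_iff)
qed

text \<open>The algebraic core: the coefficient is a product over the coordinates and therefore
  factors into a part in \<open>x\<close> and a part in \<open>y\<close>, so the multiple sum can be
  carried out iteratively, as in Fubini's theorem.\<close>

lemma (in vector_space) divided_difference_join:
  "divided_difference scale (n + m) (join_family n \<gamma> \<delta>) f (join_nodes n m \<gamma> \<delta> x y) =
    divided_difference scale m \<delta> (\<lambda>y'. divided_difference scale n \<gamma> (\<lambda>x'. f (join n m x' y')) x) y"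
proof -
  let ?z = "join_nodes n m \<gamma> \<delta> x y"
  let ?c = "\<lambda>n \<gamma> x j. \<Prod>i<n. \<Prod>k\<in>{..\<gamma> i} - {j i}. 1 / (x (i, j i) - x (i, k))"
  let ?J = "\<Pi>\<^sub>E i\<in>{..<n}. {..\<gamma> i}" and ?K = "\<Pi>\<^sub>E i\<in>{..<m}. {..\<delta> i}"
  let ?T = "\<lambda>l. scale (?c (n + m) (join_family n \<gamma> \<delta>) ?z l) (f (\<lambda>i\<in>{..<n + m}. ?z (i, l i)))"
  let ?S = "\<lambda>(k, j). scale (?c m \<delta> y k * ?c n \<gamma> x j)
    (f (join n m (\<lambda>i\<in>{..<n}. x (i, j i)) (\<lambda>i\<in>{..<m}. y (i, k i))))"
  have dom: "(\<Pi>\<^sub>E i\<in>{..<n + m}. {..join_family n \<gamma> \<delta> i}) =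
      Pi\<^sub>E {..<n + m} (join_family n (\<lambda>i. {..\<gamma> i}) (\<lambda>i. {..\<delta> i}))"
    by (intro arg_cong2[of _ _ _ _ Pi\<^sub>E]) (auto simp: join_family_def fun_eq_iff)
  have term_eq: "?T (join n m j k) = ?S (k, j)" if j: "j \<in> ?J" and k: "k \<in> ?K" for j k
  proof -
    have jk: "\<And>i. i < n \<Longrightarrow> j i \<le> \<gamma> i" "\<And>i. i < m \<Longrightarrow> k i \<le> \<delta> i"
      using PiE_mem[OF j] PiE_mem[OF k] by auto
    let ?l = "join n m j k"
    have l: "\<And>i. i < n \<Longrightarrow> ?l i = j i" "\<And>i. i < m \<Longrightarrow> ?l (n + i) = k i"
      by (simp_all add: join_def)
    have "?c (n + m) (join_family n \<gamma> \<delta>) ?z ?l = ?c n \<gamma> x j * ?c m \<delta> y k"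
      unfolding prod_lessThan_add using jk l
      by (intro arg_cong2[of _ _ _ _ "(*)"] prod.cong) simp_all
    moreover have "(\<lambda>i\<in>{..<n + m}. ?z (i, ?l i)) =
        join n m (\<lambda>i\<in>{..<n}. x (i, j i)) (\<lambda>i\<in>{..<m}. y (i, k i))"
    proof (rule extensionalityI[of _ "{..<n + m}"])
      fix i assume "i \<in> {..<n + m}"
      then have i: "i < n + m" by simp
      then show "(\<lambda>i\<in>{..<n + m}. ?z (i, ?l i)) i =
        join n m (\<lambda>i\<in>{..<n}. x (i, j i)) (\<lambda>i\<in>{..<m}. y (i, k i)) i"
        by (cases rule: less_add_cases) (use jk l in \<open>simp_all add: join_def[of n m "restrict _ _"]\<close>)
    qed (simp_all add: join_def)
    ultimately show ?thesis by (simp add: mult.commute)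
  qed
  \<comment> \<open>The pairs are ordered with the choice \<open>k\<close> for the second group
    first, so that the outer sum is the divided difference in \<open>y\<close> and the inner one
    that in \<open>x\<close>.\<close>
  have "divided_difference scale (n + m) (join_family n \<gamma> \<delta>) f ?z = (\<Sum>q\<in>?K \<times> ?J. ?T (case q of (k, j) \<Rightarrow> join n m j k))"
    unfolding divided_difference_def dom by (rule sum.reindex_bij_betw[OF bij_betw_join, symmetric])
  also have "\<dots> = (\<Sum>q\<in>?K \<times> ?J. ?S q)"
    using term_eq by (intro sum.cong refl) auto
  also have "\<dots> = (\<Sum>k\<in>?K. \<Sum>j\<in>?J. ?S (k, j))" by (simp add: sum.cartesian_product)
  also have "\<dots> = divided_difference scale m \<delta> (\<lambda>y'. divided_difference scale n \<gamma> (\<lambda>x'. f (join n m x' y')) x) y"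
    by (simp add: divided_difference_def scale_sum_right)
  finally show ?thesis .
qed

section \<open>The exponential law\<close>

lemma sum_apply_fun: "(\<Sum>i\<in>I. h i) y = (\<Sum>i\<in>I. h i y)" for h :: "'i \<Rightarrow> 'a \<Rightarrow> 'e::comm_monoid_add"
  by (induction I rule: infinite_finite_induct) (simp_all add: zero_fun_def)

text \<open>Maps into C^beta(V,E) take values in a function type with pointwise operations, so
  evaluation at \<open>y\<close> commutes with the finite sum.\<close>

lemma divided_difference_fun_scale_apply:
  "divided_difference (fun_scale smul) n \<gamma> h x y = divided_difference smul n \<gamma> (\<lambda>x'. h x' y) x"
  by (simp add: divided_difference_def sum_apply_fun fun_scale_def)

text \<open>Serves to show that a divided difference in \<open>y\<close> depends continuously on a
  parameter \<open>x\<close>; its coefficients do not involve that parameter, so constant scalars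
  are enough.\<close>

lemma (in topological_vector_space) continuous_map_sum_scale:
  assumes "finite I" "\<And>i. i \<in> I \<Longrightarrow> continuous_map X T (h i)"
  shows "continuous_map X T (\<lambda>x. \<Sum>i\<in>I. smul (c i) (h i x))"
  using assms
proof (induction I rule: finite_induct)
  case empty
  show ?case using subspace_0[OF subspace_topspace] by simp
next
  case (insert i I)
  have "continuous_map X (prod_topology euclidean T) (\<lambda>x. (c i, h i x))"
    using insert.prems by (intro continuous_map_pairedI) auto
  from continuous_map_compose[OF this continuous_scale]
  have 1: "continuous_map X T (\<lambda>x. smul (c i) (h i x))" by (simp add: o_def)
  have 2: "continuous_map X T (\<lambda>x. \<Sum>i\<in>I. smul (c i) (h i x))" using insert by simp
  from continuous_map_compose[OF continuous_map_pairedI[OF 1 2] continuous_add]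
  show ?case using insert.hyps by (simp add: o_def)
qed

locale exponential_law = topological_vector_space smul E
  for smul :: "'k::topological_field \<Rightarrow> 'e::ab_group_add \<Rightarrow> 'e" and E :: "'e topology" +
  fixes n m :: nat and U V :: "(nat \<Rightarrow> 'k) set" and ns ms :: "nat list" and \<alpha> \<beta> :: "enat list"
  assumes U: "locally_cartesian n U" and V: "locally_cartesian m V"
    and ns: "sum_list ns = n" and ms: "sum_list ms = m" and length_\<alpha>: "length \<alpha> = length ns"
begin

abbreviation UV_maps where "UV_maps \<equiv> C_alpha smul E (ns @ ms) (join_product n m U V) (\<alpha> @ \<beta>)"
abbreviation V_maps where "V_maps \<equiv> C_alpha smul E ms V \<beta>"
abbreviation V_top where "V_top \<equiv> C_alpha_topology smul E ms V \<beta>"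
abbreviation U_maps where "U_maps \<equiv> C_alpha (fun_scale smul) V_top ns U \<alpha>"
abbreviation ext where
  "ext f P Q \<gamma> \<delta> \<equiv> dd_extension smul E (n + m) (join_family n P Q) (join_family n \<gamma> \<delta>) f"

abbreviation U_index where "U_index P \<gamma> \<equiv> cartesian_open_in n U P \<and> \<gamma> \<in> admissible_indices ns \<alpha>"
abbreviation V_index where "V_index Q \<delta> \<equiv> cartesian_open_in m V Q \<and> \<delta> \<in> admissible_indices ms \<beta>"

lemma Hausdorff_V_top: "Hausdorff_space V_top"
  by (rule Hausdorff_space_C_alpha_topology[OF Hausdorff]) (simp_all add: ms V)

lemma UV_index:
  assumes "U_index P \<gamma>" "V_index Q \<delta>"
  shows "cartesian_open_in (n + m) (join_product n m U V) (join_family n P Q)"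
    "join_family n \<gamma> \<delta> \<in> admissible_indices (ns @ ms) (\<alpha> @ \<beta>)"
  using assms U V admissible_indices_append[OF length_\<alpha>, of \<gamma> \<delta> ms \<beta>]
  by (simp_all add: cartesian_open_in_join locally_cartesian_def ns)

lemma UV_index_split:
  assumes W: "cartesian_open_in (n + m) (join_product n m U V) W"
    and \<epsilon>: "\<epsilon> \<in> admissible_indices (ns @ ms) (\<alpha> @ \<beta>)" and ne: "Pi\<^sub>E {..<n + m} W \<noteq> {}"
  obtains P Q \<gamma> \<delta> where "W = join_family n P Q" "\<epsilon> = join_family n \<gamma> \<delta>" "U_index P \<gamma>" "V_index Q \<delta>"
proof (rule that)
  show eq: "W = join_family n W (\<lambda>i. W (n + i))" "\<epsilon> = join_family n \<epsilon> (\<lambda>i. \<epsilon> (n + i))"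
    by (simp_all add: join_family_split)
  have "U \<subseteq> topspace (coord_space n)" "V \<subseteq> topspace (coord_space m)"
    using U V unfolding locally_cartesian_def by blast+
  note cartesian_open_in_split[OF W ne this]
  moreover have "\<epsilon> \<in> admissible_indices ns \<alpha>" "(\<lambda>i. \<epsilon> (n + i)) \<in> admissible_indices ms \<beta>"
    using \<epsilon> admissible_indices_append[OF length_\<alpha>, of \<epsilon> "\<lambda>i. \<epsilon> (n + i)" ms \<beta>]
    by (simp_all add: ns join_family_split)
  ultimately show "U_index W \<epsilon>" "V_index (\<lambda>i. W (n + i)) (\<lambda>i. \<epsilon> (n + i))" by simp_all
qed

section \<open>Extensions of a map on products of cartesian sets\<close>

context
  fixes f P Q \<gamma> \<delta>
  assumes f: "f \<in> UV_maps" and P: "U_index P \<gamma>" and Q: "V_index Q \<delta>"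
begin

lemma is_dd_extension_ext:
  "is_dd_extension smul E (n + m) (join_family n P Q) (join_family n \<gamma> \<delta>) f (ext f P Q \<gamma> \<delta>)"
  using C_alpha_dd_extension[OF f Hausdorff, of "join_family n P Q" "join_family n \<gamma> \<delta>"] UV_index[OF P Q]
  by (simp add: ns ms)

lemma continuous_map_ext:
  "continuous_map (prod_topology (node_space n P \<gamma>) (node_space m Q \<delta>)) E
     (\<lambda>(x, y). ext f P Q \<gamma> \<delta> (join_nodes n m \<gamma> \<delta> x y))"
  using continuous_map_compose[OF continuous_map_join_nodes dd_extensionD(1)[OF is_dd_extension_ext]]
  by (simp add: o_def case_prod_unfold)

lemma continuous_map_ext_left:
  assumes "y \<in> topspace (node_space m Q \<delta>)"
  shows "continuous_map (node_space n P \<gamma>) E (\<lambda>x. ext f P Q \<gamma> \<delta> (join_nodes n m \<gamma> \<delta> x y))"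
proof -
  have "continuous_map (node_space n P \<gamma>) (prod_topology (node_space n P \<gamma>) (node_space m Q \<delta>)) (\<lambda>x. (x, y))"
    using assms by (intro continuous_map_pairedI) auto
  from continuous_map_compose[OF this continuous_map_ext] show ?thesis by (simp add: o_def)
qed

lemma continuous_map_ext_right:
  assumes "x \<in> topspace (node_space n P \<gamma>)"
  shows "continuous_map (node_space m Q \<delta>) E (\<lambda>y. ext f P Q \<gamma> \<delta> (join_nodes n m \<gamma> \<delta> x y))"
proof -
  have "continuous_map (node_space m Q \<delta>) (prod_topology (node_space n P \<gamma>) (node_space m Q \<delta>)) (\<lambda>y. (x, y))"
    using assms by (intro continuous_map_pairedI) auto
  from continuous_map_compose[OF this continuous_map_ext] show ?thesis by (simp add: o_def)
qed

lemma ext_distinct: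
  assumes "x \<in> distinct_nodes n P \<gamma>" "y \<in> distinct_nodes m Q \<delta>"
  shows "ext f P Q \<gamma> \<delta> (join_nodes n m \<gamma> \<delta> x y) =
    divided_difference smul m \<delta> (\<lambda>y'. divided_difference smul n \<gamma> (\<lambda>x'. f (join n m x' y')) x) y"
  using dd_extensionD(4)[OF is_dd_extension_ext join_nodes_distinct[OF assms]] divided_difference_join
  by simp

end

text \<open>The value at \<open>x\<close> of the extension of \<open>(f\<^sup>\<or>)\<^sup>>\<^sup>\<gamma>\<^sup><\<close>, glued from the extensions of \<open>f\<close> on \<open>P \<times> Q\<close> for
  varying \<open>Q\<close>; by density it does not depend on the choice of \<open>Q\<close>.\<close>

definition glued_ext where
  "glued_ext f P \<gamma> x = zero_ext V (\<lambda>y. ext f P (SOME Q. cartesian_open_in m V Q \<and> y \<in> Pi\<^sub>E {..<m} Q) \<gamma>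
     (\<lambda>_. 0) (join_nodes n m \<gamma> (\<lambda>_. 0) x (single_nodes m y)))"

lemma V_index_0: "cartesian_open_in m V Q \<Longrightarrow> V_index Q (\<lambda>_. 0)"
  by (simp add: zero_in_admissible_indices)

lemma V_cartesian_neighbourhood:
  assumes "y \<in> V"
  obtains Q where "cartesian_open_in m V Q" "y \<in> Pi\<^sub>E {..<m} Q"
  using V assms unfolding locally_cartesian_def by blast

lemma U_cartesian_neighbourhood:
  assumes "x \<in> U"
  obtains P where "cartesian_open_in n U P" "x \<in> Pi\<^sub>E {..<n} P"
  using U assms unfolding locally_cartesian_def by blast

context
  fixes f P \<gamma>
  assumes f: "f \<in> UV_maps" and P: "U_index P \<gamma>"
begin

lemma cartesian_P: "cartesian_factors n P"
  using P by (simp add: cartesian_open_in_def)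

lemma ext_single_distinct:
  assumes Q: "cartesian_open_in m V Q" "y \<in> Pi\<^sub>E {..<m} Q" and x: "x \<in> distinct_nodes n P \<gamma>"
  shows "ext f P Q \<gamma> (\<lambda>_. 0) (join_nodes n m \<gamma> (\<lambda>_. 0) x (single_nodes m y)) =
    divided_difference smul n \<gamma> (\<lambda>x'. f (join n m x' y)) x"
  using ext_distinct[OF f P V_index_0[OF Q(1)] x single_nodes_distinct[OF Q(2)]]
    divided_difference_single_nodes[of smul, OF scale_one Q(2)] by simp

text \<open>For distinct nodes \<open>x\<close> either choice of \<open>Q\<close> yields the divided
  difference in \<open>x\<close> alone of the map with second argument \<open>y\<close>, an
  expression in which \<open>Q\<close> does not occur. With \<open>y\<close> fixed both sides are
  continuous in \<open>x\<close>, so density in \<open>x\<close> is enough.\<close>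

lemma glued_ext_eq:
  assumes Q: "cartesian_open_in m V Q" "y \<in> Pi\<^sub>E {..<m} Q" and x: "x \<in> topspace (node_space n P \<gamma>)"
  shows "glued_ext f P \<gamma> x y = ext f P Q \<gamma> (\<lambda>_. 0) (join_nodes n m \<gamma> (\<lambda>_. 0) x (single_nodes m y))"
proof -
  define R where "R = (SOME Q. cartesian_open_in m V Q \<and> y \<in> Pi\<^sub>E {..<m} Q)"
  have R: "cartesian_open_in m V R" "y \<in> Pi\<^sub>E {..<m} R"
    using someI[of "\<lambda>Q. cartesian_open_in m V Q \<and> y \<in> Pi\<^sub>E {..<m} Q" Q] Q unfolding R_def by simp_all
  have "y \<in> V" using cartesian_open_in_subset[OF Q(1)] Q(2) by (rule subsetD)
  then have "glued_ext f P \<gamma> x y = ext f P R \<gamma> (\<lambda>_. 0) (join_nodes n m \<gamma> (\<lambda>_. 0) x (single_nodes m y))"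
    by (simp add: glued_ext_def zero_ext_def flip: R_def)
  also have "\<dots> = ext f P Q \<gamma> (\<lambda>_. 0) (join_nodes n m \<gamma> (\<lambda>_. 0) x (single_nodes m y))"
    by (rule continuous_map_eq_on_distinct_nodes[OF cartesian_P Hausdorff
          continuous_map_ext_left[OF f P V_index_0[OF R(1)] single_nodes_topspace[OF R(2)]]
          continuous_map_ext_left[OF f P V_index_0[OF Q(1)] single_nodes_topspace[OF Q(2)]] _ x])
      (simp add: ext_single_distinct[OF R] ext_single_distinct[OF Q])
  finally show ?thesis .
qed

lemma glued_ext_distinct:
  assumes "y \<in> V" "x \<in> distinct_nodes n P \<gamma>"
  shows "glued_ext f P \<gamma> x y = divided_difference smul n \<gamma> (\<lambda>x'. f (join n m x' y)) x"
proof -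
  obtain Q where Q: "cartesian_open_in m V Q" "y \<in> Pi\<^sub>E {..<m} Q"
    using V_cartesian_neighbourhood assms(1) .
  have "x \<in> topspace (node_space n P \<gamma>)" using assms(2) distinct_nodes_subset by (rule rev_subsetD)
  then show ?thesis using glued_ext_eq[OF Q] ext_single_distinct[OF Q assms(2)] by simp
qed

lemma continuous_map_glued_ext_left:
  assumes Q: "cartesian_open_in m V Q" "y \<in> Pi\<^sub>E {..<m} Q"
  shows "continuous_map (node_space n P \<gamma>) E (\<lambda>x. glued_ext f P \<gamma> x y)"
  using continuous_map_ext_left[OF f P V_index_0[OF Q(1)] single_nodes_topspace[OF Q(2)]]
  by (rule continuous_map_eq) (simp add: glued_ext_eq[OF Q])

text \<open>Shows that the glued function, built with \<open>\<delta> = 0\<close> only, also has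
  extensions of every admissible order \<open>\<delta>\<close>, provided by those of
  \<open>f\<close> for the joined index.\<close>

lemma is_dd_extension_glued_ext:
  assumes Q: "V_index Q \<delta>" and x: "x \<in> topspace (node_space n P \<gamma>)"
  shows "is_dd_extension smul E m Q \<delta> (glued_ext f P \<gamma> x)
    (restrict (\<lambda>y. ext f P Q \<gamma> \<delta> (join_nodes n m \<gamma> \<delta> x y)) (topspace (node_space m Q \<delta>)))"
proof (rule is_dd_extension_restrictI[OF continuous_map_ext_right[OF f P Q x]])
  fix y assume y: "y \<in> distinct_nodes m Q \<delta>"
  then have yt: "y \<in> topspace (node_space m Q \<delta>)" using distinct_nodes_subset by (rule rev_subsetD)
  have Q': "cartesian_open_in m V Q" using Q by simp
  \<comment> \<open>For a fixed distinct tuple \<open>y\<close> both sides are regarded as functions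
    of \<open>x\<close>. They are continuous and agree for distinct \<open>x\<close> by the iterated
    formula, hence agree for all \<open>x\<close>.\<close>
  have "continuous_map (node_space n P \<gamma>) E (\<lambda>x. divided_difference smul m \<delta> (glued_ext f P \<gamma> x) y)"
    unfolding divided_difference_def
    by (rule continuous_map_sum_scale)
      (auto intro!: finite_PiE continuous_map_glued_ext_left[OF Q'] select_node[OF yt])
  moreover have "ext f P Q \<gamma> \<delta> (join_nodes n m \<gamma> \<delta> x y) = divided_difference smul m \<delta> (glued_ext f P \<gamma> x) y"
    if xd: "x \<in> distinct_nodes n P \<gamma>" for x
    unfolding ext_distinct[OF f P Q xd y]
  proof (rule divided_difference_cong)
    fix j assume j: "j \<in> (\<Pi>\<^sub>E i\<in>{..<m}. {..\<delta> i})"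
    have "(\<lambda>i\<in>{..<m}. y (i, j i)) \<in> V"
      using cartesian_open_in_subset[OF Q'] select_node[OF yt j] by (rule subsetD)
    from glued_ext_distinct[OF this xd]
    show "divided_difference smul n \<gamma> (\<lambda>x'. f (join n m x' (\<lambda>i\<in>{..<m}. y (i, j i)))) x =
      glued_ext f P \<gamma> x (\<lambda>i\<in>{..<m}. y (i, j i))" by (rule sym)
  qed
  ultimately show "ext f P Q \<gamma> \<delta> (join_nodes n m \<gamma> \<delta> x y) = divided_difference smul m \<delta> (glued_ext f P \<gamma> x) y"
    using x by (rule continuous_map_eq_on_distinct_nodes[OF cartesian_P Hausdorff
          continuous_map_ext_left[OF f P Q yt]])
qed

lemma dd_extension_glued_ext:
  assumes Q: "V_index Q \<delta>" and x: "x \<in> topspace (node_space n P \<gamma>)"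
    and y: "y \<in> topspace (node_space m Q \<delta>)"
  shows "dd_extension smul E m Q \<delta> (glued_ext f P \<gamma> x) y = ext f P Q \<gamma> \<delta> (join_nodes n m \<gamma> \<delta> x y)"
proof -
  have "cartesian_factors m Q" using Q by (simp add: cartesian_open_in_def)
  from dd_extension_eq[OF this Hausdorff is_dd_extension_glued_ext[OF Q x]] show ?thesis using y by simp
qed

lemma glued_ext_in_V_maps:
  assumes x: "x \<in> topspace (node_space n P \<gamma>)"
  shows "glued_ext f P \<gamma> x \<in> V_maps"
  unfolding C_alpha_iff ms
proof (intro conjI allI ballI impI)
  fix y assume "y \<in> V"
  then obtain Q where Q: "cartesian_open_in m V Q" "y \<in> Pi\<^sub>E {..<m} Q" by (rule V_cartesian_neighbourhood)
  show "glued_ext f P \<gamma> x y \<in> topspace E"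
    using continuous_map_image_subset_topspace[OF continuous_map_glued_ext_left[OF Q]] x by blast
next
  fix y assume "y \<notin> V"
  then show "glued_ext f P \<gamma> x y = 0" by (simp add: glued_ext_def zero_ext_def)
next
  fix Q \<delta> assume "cartesian_open_in m V Q" "\<delta> \<in> admissible_indices ms \<beta>"
  then show "\<exists>g. is_dd_extension smul E m Q \<delta> (glued_ext f P \<gamma> x) g"
    using is_dd_extension_glued_ext[OF _ x] by blast
qed

text \<open>The preimage of a subbasic set given by \<open>L\<close> and \<open>W\<close> consists
  of the \<open>x\<close> for which the extension of \<open>f\<close> maps all pairs with
  \<open>y \<in> L\<close> into \<open>W\<close>; it is open by the tube lemma.\<close>

lemma continuous_map_glued_ext: "continuous_map (node_space n P \<gamma>) V_top (glued_ext f P \<gamma>)"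
  unfolding C_alpha_topology_generated[OF topology_generated_by_openin[symmetric] Hausdorff ms[symmetric]]
proof (rule continuous_on_generated_topo)
  let ?X = "node_space n P \<gamma>"
  let ?\<S> = "{{g \<in> V_maps. dd_extension smul E m Q \<delta> g ` L \<subseteq> W} | Q \<delta> L W. cartesian_open_in m V Q \<and>
    \<delta> \<in> admissible_indices ms \<beta> \<and> compactin (node_space m Q \<delta>) L \<and> W \<in> {W. openin E W}}"
  show "glued_ext f P \<gamma> ` topspace ?X \<subseteq> \<Union> (insert V_maps ?\<S>)"
    using glued_ext_in_V_maps by blast
  fix S assume "S \<in> insert V_maps ?\<S>"
  then consider "S = V_maps" | Q \<delta> L W where "S = {g \<in> V_maps. dd_extension smul E m Q \<delta> g ` L \<subseteq> W}"
    "V_index Q \<delta>" "compactin (node_space m Q \<delta>) L" "openin E W" by blast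
  then show "openin ?X (glued_ext f P \<gamma> -` S \<inter> topspace ?X)"
  proof cases
    case 1
    then have "glued_ext f P \<gamma> -` S \<inter> topspace ?X = topspace ?X" using glued_ext_in_V_maps by blast
    then show ?thesis by simp
  next
    case (2 Q \<delta> L W)
    have L: "y \<in> topspace (node_space m Q \<delta>)" if "y \<in> L" for y
      using compactin_subset_topspace[OF 2(3)] that by (rule subsetD)
    have "dd_extension smul E m Q \<delta> (glued_ext f P \<gamma> x) ` L \<subseteq> W \<longleftrightarrow>
        (\<forall>y\<in>L. ext f P Q \<gamma> \<delta> (join_nodes n m \<gamma> \<delta> x y) \<in> W)" if "x \<in> topspace ?X" for x
      using dd_extension_glued_ext[OF 2(2) that L] by (simp add: image_subset_iff)
    then have "glued_ext f P \<gamma> -` S \<inter> topspace ?X = {x \<in> topspace ?X. \<forall>y\<in>L.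
        (case (x, y) of (x, y) \<Rightarrow> ext f P Q \<gamma> \<delta> (join_nodes n m \<gamma> \<delta> x y)) \<in> W}"
      unfolding 2(1) using glued_ext_in_V_maps by auto
    then show ?thesis using openin_tube[OF continuous_map_ext[OF f P 2(2)] 2(3,4)] by simp
  qed
qed

text \<open>The equality is one of total functions of \<open>y\<close>, so the points outside
  \<open>V\<close> have to be covered too; there both sides vanish.\<close>

lemma glued_ext_distinct_vee:
  assumes x: "x \<in> distinct_nodes n P \<gamma>"
  shows "glued_ext f P \<gamma> x = divided_difference (fun_scale smul) n \<gamma> (vee n m U V f) x"
proof (rule ext)
  fix y
  have xt: "x \<in> topspace (node_space n P \<gamma>)" using x distinct_nodes_subset by (rule rev_subsetD)
  have P': "cartesian_open_in n U P" using P by simp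
  have xU: "(\<lambda>i\<in>{..<n}. x (i, j i)) \<in> U" if "j \<in> (\<Pi>\<^sub>E i\<in>{..<n}. {..\<gamma> i})" for j
    using cartesian_open_in_subset[OF P'] select_node[OF xt that] by (rule subsetD)
  show "glued_ext f P \<gamma> x y = divided_difference (fun_scale smul) n \<gamma> (vee n m U V f) x y"
  proof (cases "y \<in> V")
    case True
    have "glued_ext f P \<gamma> x y = divided_difference smul n \<gamma> (\<lambda>x'. f (join n m x' y)) x"
      using True x by (rule glued_ext_distinct)
    also have "\<dots> = divided_difference smul n \<gamma> (\<lambda>x'. vee n m U V f x' y) x"
      by (rule divided_difference_cong) (simp add: vee_def slice_def zero_ext_def xU True)
    finally show ?thesis by (simp add: divided_difference_fun_scale_apply)
  next
    case False
    then have "vee n m U V f x' y = 0" for x' by (simp add: vee_def slice_def zero_ext_def)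
    then show ?thesis using False unfolding divided_difference_fun_scale_apply
      by (simp add: divided_difference_def glued_ext_def zero_ext_def)
  qed
qed

lemma is_dd_extension_vee:
  "is_dd_extension (fun_scale smul) V_top n P \<gamma> (vee n m U V f)
     (restrict (glued_ext f P \<gamma>) (topspace (node_space n P \<gamma>)))"
  by (rule is_dd_extension_restrictI[OF continuous_map_glued_ext glued_ext_distinct_vee])

lemma dd_extension_vee:
  assumes "V_index Q \<delta>" "x \<in> topspace (node_space n P \<gamma>)" "y \<in> topspace (node_space m Q \<delta>)"
  shows "dd_extension smul E m Q \<delta> (dd_extension (fun_scale smul) V_top n P \<gamma> (vee n m U V f) x) y =
    ext f P Q \<gamma> \<delta> (join_nodes n m \<gamma> \<delta> x y)"
  using dd_extension_eq[OF cartesian_P Hausdorff_V_top is_dd_extension_vee] assms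
  by (simp add: dd_extension_glued_ext)

end

text \<open>The slice is the case \<open>\<gamma> = 0\<close> of the glued extension, taken at the
  single node tuple of \<open>x\<close>.\<close>

lemma slice_in_V_maps:
  assumes f: "f \<in> UV_maps" and x: "x \<in> U"
  shows "slice n m V f x \<in> V_maps"
proof -
  obtain P where P: "cartesian_open_in n U P" "x \<in> Pi\<^sub>E {..<n} P"
    using x by (rule U_cartesian_neighbourhood)
  then have P0: "U_index P (\<lambda>_. 0)" by (simp add: zero_in_admissible_indices)
  have "glued_ext f P (\<lambda>_. 0) (single_nodes n x) = vee n m U V f x"
    unfolding glued_ext_distinct_vee[OF f P0 single_nodes_distinct[OF P(2)]]
    by (rule divided_difference_single_nodes[OF _ P(2)]) (simp add: fun_scale_def)
  then show ?thesis
    using glued_ext_in_V_maps[OF f P0 single_nodes_topspace[OF P(2)]] x by (simp add: vee_def zero_ext_def)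
qed

lemma vee_in_U_maps:
  assumes f: "f \<in> UV_maps"
  shows "vee n m U V f \<in> U_maps"
proof (rule C_alpha_iff[THEN iffD2], unfold ns topspace_C_alpha_topology, intro conjI allI ballI impI)
  show "vee n m U V f x \<in> V_maps" if "x \<in> U" for x
    using slice_in_V_maps[OF f that] that by (simp add: vee_def zero_ext_def)
  show "vee n m U V f x = 0" if "x \<notin> U" for x
    using that by (simp add: vee_def zero_ext_def)
  show "\<exists>g. is_dd_extension (fun_scale smul) V_top n P \<gamma> (vee n m U V f) g"
    if "cartesian_open_in n U P" "\<gamma> \<in> admissible_indices ns \<alpha>" for P \<gamma>
    using is_dd_extension_vee[OF f] that by blast
qed

section \<open>Injectivity, and surjectivity over a metrizable field\<close>

lemma UV_zero: "f \<in> UV_maps \<Longrightarrow> z \<notin> join_product n m U V \<Longrightarrow> f z = 0"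
  unfolding C_alpha_iff by blast

lemma inj_on_vee: "inj_on (vee n m U V) UV_maps"
proof (rule inj_onI)
  fix f g assume f: "f \<in> UV_maps" and g: "g \<in> UV_maps" and eq: "vee n m U V f = vee n m U V g"
  show "f = g"
  proof (rule HOL.ext)
    fix z
    show "f z = g z"
    proof (cases "z \<in> join_product n m U V")
      case True
      then obtain x y where z: "z = join n m x y" "x \<in> U" "y \<in> V" by (rule join_productE)
      have "vee n m U V f x y = vee n m U V g x y" using eq by simp
      then show ?thesis using z by (simp add: vee_def slice_def zero_ext_def)
    qed (simp add: UV_zero[OF f] UV_zero[OF g])
  qed
qed

text \<open>The uncurried map has the right divided differences over any field. Metrizability enters
  only in the joint continuity of the twofold extension \<open>F\<close>.\<close>

lemma vee_surjective:
  assumes K: "metrizable_space (euclidean :: 'k topology)" and h: "h \<in> U_maps"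
  shows "\<exists>f\<in>UV_maps. vee n m U V f = h"
proof -
  \<comment> \<open>The only candidate: members of \<open>UV_maps\<close> vanish off the product,
    and since \<open>U\<close> and \<open>V\<close> consist of extensional functions, a point of the
    product determines both of its parts.\<close>
  define f where "f = zero_ext (join_product n m U V) (\<lambda>z. h (restrict z {..<n}) (\<lambda>i\<in>{..<m}. z (n + i)))"
  have Usub: "x \<in> extensional {..<n}" if "x \<in> U" for x
    using U that unfolding locally_cartesian_def topspace_coord_space by blast
  have Vsub: "y \<in> extensional {..<m}" if "y \<in> V" for y
    using V that unfolding locally_cartesian_def topspace_coord_space by blast
  have f_join: "f (join n m x y) = h x y" if xy: "x \<in> U" "y \<in> V" for x y
    using restrict_join[OF Usub[OF xy(1)]] shift_join[OF Vsub[OF xy(2)]] join_productI[OF xy]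
    by (simp add: f_def zero_ext_def)
  have hV: "h x \<in> V_maps" if "x \<in> U" for x
    using h[THEN C_alpha_iff[THEN iffD1]] that unfolding topspace_C_alpha_topology by blast
  have hE: "h x y \<in> topspace E" if "x \<in> U" "y \<in> V" for x y
    using hV[OF that(1), THEN C_alpha_iff[THEN iffD1]] that(2) by blast
  have h0: "h x = 0" if "x \<notin> U" for x
    using h[THEN C_alpha_iff[THEN iffD1]] that by blast
  have hV0: "h x y = 0" if "x \<in> U" "y \<notin> V" for x y
    using hV[OF that(1), THEN C_alpha_iff[THEN iffD1]] that(2) by blast
  have "vee n m U V f = h"
  proof (intro HOL.ext)
    fix x y
    show "vee n m U V f x y = h x y"
      by (cases "x \<in> U"; cases "y \<in> V") (simp_all add: vee_def slice_def zero_ext_def f_join h0 hV0)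
  qed
  moreover have "f \<in> UV_maps"
  proof (rule C_alpha_iff[THEN iffD2], intro conjI allI ballI impI)
    fix z assume "z \<in> join_product n m U V"
    then obtain x y where "z = join n m x y" "x \<in> U" "y \<in> V" by (rule join_productE)
    then show "f z \<in> topspace E" by (simp add: f_join hE)
  next
    fix z assume "z \<notin> join_product n m U V"
    then show "f z = 0" by (simp add: f_def zero_ext_def)
  next
    fix W \<epsilon>
    assume W: "cartesian_open_in (sum_list (ns @ ms)) (join_product n m U V) W"
      and \<epsilon>: "\<epsilon> \<in> admissible_indices (ns @ ms) (\<alpha> @ \<beta>)"
    have W': "cartesian_open_in (n + m) (join_product n m U V) W" using W by (simp add: ns ms)
    show "\<exists>g. is_dd_extension smul E (sum_list (ns @ ms)) W \<epsilon> f g"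
    proof (cases "Pi\<^sub>E {..<n + m} W = {}")
      case True
      \<comment> \<open>An empty product cannot be split into open factors. However, one factor is
        then empty, there are no node tuples, and extensionality on the empty set is all that
        remains to be satisfied.\<close>
      then obtain i where i: "i < n + m" "W i = {}" by (auto simp: PiE_eq_empty_iff)
      then have "(i, 0) \<in> node_index (n + m) \<epsilon>" by simp
      then have "topspace (node_space (n + m) W \<epsilon>) = {}"
        unfolding topspace_node_space PiE_eq_empty_iff using i(2) by (intro bexI[of _ "(i, 0)"]) simp
      then have "is_dd_extension smul E (n + m) W \<epsilon> f (\<lambda>_. undefined)"
        by (simp add: is_dd_extension_def continuous_maps_def distinct_nodes_def continuous_map_def)
      then show ?thesis by (auto simp: ns ms)
    next
      case False
      obtain P Q \<gamma> \<delta> where eq: "W = join_family n P Q" "\<epsilon> = join_family n \<gamma> \<delta>"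
        and P: "U_index P \<gamma>" and Q: "V_index Q \<delta>"
        by (rule UV_index_split[OF W' \<epsilon> False])
      let ?X = "node_space n P \<gamma>" and ?Y = "node_space m Q \<delta>"
      let ?Z = "node_space (n + m) (join_family n P Q) (join_family n \<gamma> \<delta>)"
      \<comment> \<open>The extension is made in two stages: \<open>e\<close> extends
        \<open>h\<close> in the first group of variables with values in \<open>V_maps\<close>, and
        \<open>F x\<close> extends the map \<open>e x\<close> in the second group.\<close>
      define e where "e = dd_extension (fun_scale smul) V_top n P \<gamma> h"
      have e: "is_dd_extension (fun_scale smul) V_top n P \<gamma> h e"
        using C_alpha_dd_extension[OF h Hausdorff_V_top, of P \<gamma>] P by (simp add: ns e_def)
      have eV: "e x \<in> V_maps" if "x \<in> topspace ?X" for x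
        using continuous_map_image_subset_topspace[OF dd_extensionD(1)[OF e]] that
        unfolding topspace_C_alpha_topology by blast
      define F where "F x = dd_extension smul E m Q \<delta> (e x)" for x
      have F: "is_dd_extension smul E m Q \<delta> (e x) (F x)" if "x \<in> topspace ?X" for x
        using C_alpha_dd_extension[OF eV[OF that] Hausdorff, of Q \<delta>] Q by (simp add: ms F_def)
      have F_cont: "continuous_map (prod_topology ?X ?Y) E (\<lambda>(x, y). F x y)"
      proof (rule continuous_map_uncurry_metrizable)
        show "metrizable_space ?X" "metrizable_space ?Y" by (simp_all add: metrizable_space_node_space K)
        show "continuous_map ?Y E (F x)" if "x \<in> topspace ?X" for x
          using dd_extensionD(1)[OF F[OF that]] .
        fix L W' assume L: "compactin ?Y L" and W': "openin E W'"
        \<comment> \<open>The hypothesis on compact \<open>L\<close> is the continuity of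
          \<open>e\<close> into \<open>V_top\<close>, tested on one subbasic set.\<close>
        have "openin V_top {g \<in> V_maps. dd_extension smul E m Q \<delta> g ` L \<subseteq> W'}"
          unfolding C_alpha_topology_generated[OF topology_generated_by_openin[symmetric] Hausdorff ms[symmetric]]
          using Q L W' by (intro topology_generated_by_Basis insertI2 CollectI exI conjI) (rule refl, auto)
        from openin_continuous_map_preimage[OF dd_extensionD(1)[OF e] this]
        have "openin ?X {x \<in> topspace ?X. e x \<in> {g \<in> V_maps. dd_extension smul E m Q \<delta> g ` L \<subseteq> W'}}" .
        moreover have "{x \<in> topspace ?X. e x \<in> {g \<in> V_maps. dd_extension smul E m Q \<delta> g ` L \<subseteq> W'}} =
            {x \<in> topspace ?X. F x ` L \<subseteq> W'}"
          using eV by (auto simp: F_def)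
        ultimately show "openin ?X {x \<in> topspace ?X. F x ` L \<subseteq> W'}" by simp
      qed
      have "continuous_map ?Z (prod_topology ?X ?Y) (\<lambda>z. (left_nodes n \<gamma> z, right_nodes n m \<delta> z))"
        by (intro continuous_map_pairedI continuous_map_left_nodes continuous_map_right_nodes)
      from continuous_map_compose[OF this F_cont]
      have "continuous_map ?Z E (\<lambda>z. F (left_nodes n \<gamma> z) (right_nodes n m \<delta> z))" by (simp add: o_def)
      moreover have "F (left_nodes n \<gamma> z) (right_nodes n m \<delta> z) =
          divided_difference smul (n + m) (join_family n \<gamma> \<delta>) f z"
        if z: "z \<in> distinct_nodes (n + m) (join_family n P Q) (join_family n \<gamma> \<delta>)" for z
      proof -
        define x y where "x = left_nodes n \<gamma> z" and "y = right_nodes n m \<delta> z"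
        have x: "x \<in> distinct_nodes n P \<gamma>" and y: "y \<in> distinct_nodes m Q \<delta>"
          unfolding x_def y_def using split_nodes_distinct[OF z] by simp_all
        have xt: "x \<in> topspace ?X" using x distinct_nodes_subset by (rule rev_subsetD)
        have yt: "y \<in> topspace ?Y" using y distinct_nodes_subset by (rule rev_subsetD)
        have "z \<in> topspace ?Z" using z distinct_nodes_subset by (rule rev_subsetD)
        then have zJ: "z = join_nodes n m \<gamma> \<delta> x y"
          unfolding x_def y_def topspace_node_space by (simp add: join_nodes_split PiE_def)
        have "F x y = divided_difference smul m \<delta> (e x) y"
          using dd_extensionD(4)[OF F[OF xt] y] .
        also have "e x = divided_difference (fun_scale smul) n \<gamma> h x"
          using dd_extensionD(4)[OF e x] .
        also have "divided_difference smul m \<delta> (divided_difference (fun_scale smul) n \<gamma> h x) y =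
            divided_difference smul m \<delta> (\<lambda>y'. divided_difference smul n \<gamma> (\<lambda>x'. f (join n m x' y')) x) y"
        \<comment> \<open>Both divided differences evaluate only at points selected from the nodes;
          these lie in \<open>U\<close> and \<open>V\<close>, where \<open>f\<close> uncurries
          \<open>h\<close>.\<close>
        proof (rule divided_difference_cong, unfold divided_difference_fun_scale_apply, rule divided_difference_cong)
          fix k j assume k: "k \<in> (\<Pi>\<^sub>E i\<in>{..<m}. {..\<delta> i})" and j: "j \<in> (\<Pi>\<^sub>E i\<in>{..<n}. {..\<gamma> i})"
          have "(\<lambda>i\<in>{..<n}. x (i, j i)) \<in> U"
            using cartesian_open_in_subset[OF conjunct1[OF P]] select_node[OF xt j] by (rule subsetD)
          moreover have "(\<lambda>i\<in>{..<m}. y (i, k i)) \<in> V"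
            using cartesian_open_in_subset[OF conjunct1[OF Q]] select_node[OF yt k] by (rule subsetD)
          ultimately show "h (\<lambda>i\<in>{..<n}. x (i, j i)) (\<lambda>i\<in>{..<m}. y (i, k i)) =
              f (join n m (\<lambda>i\<in>{..<n}. x (i, j i)) (\<lambda>i\<in>{..<m}. y (i, k i)))"
            by (simp add: f_join)
        qed
        finally show ?thesis unfolding zJ divided_difference_join
          unfolding zJ[symmetric] x_def[symmetric] y_def[symmetric] .
      qed
      ultimately have "is_dd_extension smul E (n + m) (join_family n P Q) (join_family n \<gamma> \<delta>) f
          (restrict (\<lambda>z. F (left_nodes n \<gamma> z) (right_nodes n m \<delta> z)) (topspace ?Z))"
        by (rule is_dd_extension_restrictI)
      then show ?thesis unfolding eq[symmetric] by (auto simp: ns ms)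
    qed
  qed
  ultimately show ?thesis by blast
qed

lemma linear_vee:
  "linear_map_between (fun_scale smul) UV_maps (fun_scale (fun_scale smul)) U_maps (vee n m U V)"
  unfolding linear_map_between_def
proof (intro conjI ballI allI)
  show "vee n m U V \<in> UV_maps \<rightarrow> U_maps" using vee_in_U_maps by (rule Pi_I)
  show "vee n m U V (u + v) = vee n m U V u + vee n m U V v"
    for u v :: "(nat \<Rightarrow> 'k) \<Rightarrow> 'e"
    by (simp add: fun_eq_iff vee_def slice_def zero_ext_def)
  show "vee n m U V (fun_scale smul c u) = fun_scale (fun_scale smul) c (vee n m U V u)" for c u
    by (simp add: fun_eq_iff vee_def slice_def zero_ext_def fun_scale_def)
qed

section \<open>Comparison of the topologies\<close>

abbreviation UV_top where "UV_top \<equiv> C_alpha_topology smul E (ns @ ms) (join_product n m U V) (\<alpha> @ \<beta>)"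
abbreviation U_top where "U_top \<equiv> C_alpha_topology (fun_scale smul) V_top ns U \<alpha>"

abbreviation box_maps where
  "box_maps P Q \<gamma> \<delta> K L W \<equiv>
     {f \<in> UV_maps. \<forall>x\<in>K. \<forall>y\<in>L. ext f P Q \<gamma> \<delta> (join_nodes n m \<gamma> \<delta> x y) \<in> W}"

definition box_subbasis where
  "box_subbasis = {box_maps P Q \<gamma> \<delta> K L W | P Q \<gamma> \<delta> K L W. U_index P \<gamma> \<and> V_index Q \<delta> \<and>
     compactin (node_space n P \<gamma>) K \<and> compactin (node_space m Q \<delta>) L \<and> openin E W}"

lemma box_subbasisI:
  assumes "U_index P \<gamma>" "V_index Q \<delta>" "compactin (node_space n P \<gamma>) K" "compactin (node_space m Q \<delta>) L"
    "openin E W"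
  shows "box_maps P Q \<gamma> \<delta> K L W \<in> box_subbasis"
  unfolding box_subbasis_def using assms by (intro CollectI exI conjI) (rule refl, auto)

lemma box_subbasisE:
  assumes "S \<in> box_subbasis"
  obtains P Q \<gamma> \<delta> K L W where "S = box_maps P Q \<gamma> \<delta> K L W" "U_index P \<gamma>" "V_index Q \<delta>"
    "compactin (node_space n P \<gamma>) K" "compactin (node_space m Q \<delta>) L" "openin E W"
  using assms unfolding box_subbasis_def by blast

text \<open>A test on a compact set of node tuples is moved to the product of two node spaces by
  \<open>left_nodes\<close> and \<open>right_nodes\<close>, where compact boxes suffice. Conversely,
  \<open>join_nodes\<close> sends a compact box to a compact set, so box tests are among the
  original ones.\<close>

lemma UV_top_generated: "UV_top = topology_generated_by (insert UV_maps box_subbasis)"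
proof -
  have nm: "n + m = sum_list (ns @ ms)" by (simp add: ns ms)
  let ?\<S> = "{{f \<in> UV_maps. dd_extension smul E (n + m) W \<epsilon> f ` K \<subseteq> O'} | W \<epsilon> K O'.
    cartesian_open_in (n + m) (join_product n m U V) W \<and> \<epsilon> \<in> admissible_indices (ns @ ms) (\<alpha> @ \<beta>) \<and>
    compactin (node_space (n + m) W \<epsilon>) K \<and> O' \<in> {O'. openin E O'}}"
  have UV_top: "UV_top = topology_generated_by (insert UV_maps ?\<S>)"
    by (rule C_alpha_topology_generated[OF topology_generated_by_openin[symmetric] Hausdorff nm])
  let ?M = "topology_generated_by (insert UV_maps box_subbasis)"
  have M: "openin ?M UV_maps" by (rule topology_generated_by_Basis) simp
  have in_M: "openin ?M S" if S: "S \<in> ?\<S>" for S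
  proof -
    from S obtain W \<epsilon> K O' where S: "S = {f \<in> UV_maps. dd_extension smul E (n + m) W \<epsilon> f ` K \<subseteq> O'}"
      and W: "cartesian_open_in (n + m) (join_product n m U V) W"
      and \<epsilon>: "\<epsilon> \<in> admissible_indices (ns @ ms) (\<alpha> @ \<beta>)"
      and K: "compactin (node_space (n + m) W \<epsilon>) K" and O': "openin E O'" by blast
    show "openin ?M S"
    proof (cases "K = {}")
      case True
      then show ?thesis using M by (simp add: S)
    next
      case False
      then obtain z where "z \<in> topspace (node_space (n + m) W \<epsilon>)"
        using compactin_subset_topspace[OF K] by blast
      \<comment> \<open>Taking entry number 0 in each coordinate of \<open>z\<close> produces a
        point of the cartesian set, whose nonemptiness is required for splitting it.\<close>
      then have "(\<lambda>i\<in>{..<n + m}. z (i, (\<lambda>i\<in>{..<n + m}. 0) i)) \<in> Pi\<^sub>E {..<n + m} W"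
        by (rule select_node) (simp only: restrict_PiE_iff, simp)
      then have ne: "Pi\<^sub>E {..<n + m} W \<noteq> {}" by (rule ex_in_conv[THEN iffD1, OF exI])
      obtain P Q \<gamma> \<delta> where eq: "W = join_family n P Q" "\<epsilon> = join_family n \<gamma> \<delta>"
        and P: "U_index P \<gamma>" and Q: "V_index Q \<delta>"
        by (rule UV_index_split[OF W \<epsilon> ne])
      let ?X = "node_space n P \<gamma>" and ?Y = "node_space m Q \<delta>"
      let ?Z = "node_space (n + m) (join_family n P Q) (join_family n \<gamma> \<delta>)"
      let ?s = "\<lambda>z. (left_nodes n \<gamma> z, right_nodes n m \<delta> z)"
      let ?F = "\<lambda>f (x, y). ext f P Q \<gamma> \<delta> (join_nodes n m \<gamma> \<delta> x y)"
      have K': "compactin ?Z K" using K unfolding eq .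
      have "continuous_map ?Z (prod_topology ?X ?Y) ?s"
        by (intro continuous_map_pairedI continuous_map_left_nodes continuous_map_right_nodes)
      then have sK: "compactin (prod_topology ?X ?Y) (?s ` K)" using K' image_compactin by blast
      have "openin ?M {f \<in> UV_maps. ?F f ` (?s ` K) \<subseteq> O'}"
      proof (rule openin_compact_open_boxes[OF M Hausdorff_space_node_space Hausdorff_space_node_space _ O' _ sK])
        show "continuous_map (prod_topology ?X ?Y) E (?F f)" if "f \<in> UV_maps" for f
          using continuous_map_ext[OF that P Q] .
        fix K L assume K: "compactin ?X K" and L: "compactin ?Y L"
        have "{f \<in> UV_maps. ?F f ` (K \<times> L) \<subseteq> O'} = box_maps P Q \<gamma> \<delta> K L O'"
          by (auto simp: image_subset_iff)
        then show "openin ?M {f \<in> UV_maps. ?F f ` (K \<times> L) \<subseteq> O'}"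
          using box_subbasisI[OF P Q K L O'] by (intro topology_generated_by_Basis) simp
      qed
      moreover have "?F f (?s z) = ext f P Q \<gamma> \<delta> z" if "z \<in> K" for f z
      proof -
        have "z \<in> topspace ?Z" using compactin_subset_topspace[OF K'] that by (rule subsetD)
        then show ?thesis unfolding topspace_node_space by (simp add: join_nodes_split PiE_def)
      qed
      then have "?F f ` (?s ` K) = ext f P Q \<gamma> \<delta> ` K" for f unfolding image_image by (rule image_cong[OF refl])
      ultimately show ?thesis unfolding S eq by simp
    qed
  qed
  have in_UV_top: "openin UV_top S" if "S \<in> box_subbasis" for S
    using that
  proof (rule box_subbasisE)
    fix P Q \<gamma> \<delta> K L W
    assume S: "S = box_maps P Q \<gamma> \<delta> K L W" and P: "U_index P \<gamma>" and Q: "V_index Q \<delta>"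
      and KL: "compactin (node_space n P \<gamma>) K" "compactin (node_space m Q \<delta>) L" and W: "openin E W"
    let ?J = "\<lambda>(x, y). join_nodes n m \<gamma> \<delta> x y"
    have "compactin (prod_topology (node_space n P \<gamma>) (node_space m Q \<delta>)) (K \<times> L)"
      using KL by (simp add: compactin_Times)
    then have "compactin (node_space (n + m) (join_family n P Q) (join_family n \<gamma> \<delta>)) (?J ` (K \<times> L))"
      by (rule image_compactin[OF _ continuous_map_join_nodes])
    then have "openin UV_top {f \<in> UV_maps. ext f P Q \<gamma> \<delta> ` (?J ` (K \<times> L)) \<subseteq> W}"
      unfolding UV_top using UV_index[OF P Q] W
      by (intro topology_generated_by_Basis insertI2 CollectI exI conjI) (rule refl, auto)
    moreover have "{f \<in> UV_maps. ext f P Q \<gamma> \<delta> ` (?J ` (K \<times> L)) \<subseteq> W} = S"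
      unfolding S by (auto simp: image_subset_iff)
    ultimately show "openin UV_top S" by simp
  qed
  have UV_open: "openin UV_top UV_maps" using openin_topspace[of UV_top] by simp
  show ?thesis
    unfolding UV_top
  proof (rule topology_generated_by_eqI, unfold UV_top[symmetric])
    show "openin ?M S" if "S \<in> insert UV_maps ?\<S>" for S using that M in_M by (elim insertE) simp_all
    show "openin UV_top S" if "S \<in> insert UV_maps box_subbasis" for S
      using that UV_open in_UV_top by (elim insertE) simp_all
  qed
qed

lemma dd_extension_vee_in_V_maps:
  assumes f: "f \<in> UV_maps" and P: "U_index P \<gamma>" and x: "x \<in> topspace (node_space n P \<gamma>)"
  shows "dd_extension (fun_scale smul) V_top n P \<gamma> (vee n m U V f) x \<in> V_maps"
  using dd_extension_eq[OF cartesian_P[OF f P] Hausdorff_V_top is_dd_extension_vee[OF f P]]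
    glued_ext_in_V_maps[OF f P x] x by simp

text \<open>The nested extension of the curried map at \<open>x\<close> and \<open>y\<close> is the
  extension of \<open>f\<close> at the joined nodes, by \<open>dd_extension_vee\<close>. The
  membership conditions in the two nested sets hold automatically for curried maps.\<close>

lemma vee_box:
  assumes f: "f \<in> UV_maps" and P: "U_index P \<gamma>" and Q: "V_index Q \<delta>"
    and K: "compactin (node_space n P \<gamma>) K" and L: "compactin (node_space m Q \<delta>) L"
  shows "vee n m U V f \<in> {h \<in> U_maps. dd_extension (fun_scale smul) V_top n P \<gamma> h ` K
      \<subseteq> {g \<in> V_maps. dd_extension smul E m Q \<delta> g ` L \<subseteq> W}} \<longleftrightarrow>
    (\<forall>x\<in>K. \<forall>y\<in>L. ext f P Q \<gamma> \<delta> (join_nodes n m \<gamma> \<delta> x y) \<in> W)"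
proof -
  have x: "x \<in> topspace (node_space n P \<gamma>)" if "x \<in> K" for x
    using compactin_subset_topspace[OF K] that by (rule subsetD)
  have y: "y \<in> topspace (node_space m Q \<delta>)" if "y \<in> L" for y
    using compactin_subset_topspace[OF L] that by (rule subsetD)
  show ?thesis
    using vee_in_U_maps[OF f] dd_extension_vee_in_V_maps[OF f P x] dd_extension_vee[OF f P Q x y]
    by (simp add: image_subset_iff)
qed

text \<open>The target sets in the subbasis of \<open>U_top\<close> are drawn from the subbasis of
  \<open>V_top\<close>. Continuity holds because the resulting nested tests pull back to box tests
  or to everything; the inverse is continuous because every box test is such a pullback.\<close>

lemma embedding_map_vee: "embedding_map UV_top U_top (vee n m U V)"
proof (rule embedding_map_generated[OF UV_top_generated topspace_C_alpha_topology _ inj_on_vee])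
  let ?\<B> = "{{g \<in> V_maps. dd_extension smul E m Q \<delta> g ` L \<subseteq> W} | Q \<delta> L W. cartesian_open_in m V Q \<and>
    \<delta> \<in> admissible_indices ms \<beta> \<and> compactin (node_space m Q \<delta>) L \<and> W \<in> {W. openin E W}}"
  have V_top: "V_top = topology_generated_by (insert V_maps ?\<B>)"
    by (rule C_alpha_topology_generated[OF topology_generated_by_openin[symmetric] Hausdorff ms[symmetric]])
  let ?dd = "\<lambda>P \<gamma>. dd_extension (fun_scale smul) V_top n P \<gamma>"
  let ?\<D> = "{{h \<in> U_maps. ?dd P \<gamma> h ` K \<subseteq> S} | P \<gamma> K S. cartesian_open_in n U P \<and>
    \<gamma> \<in> admissible_indices ns \<alpha> \<and> compactin (node_space n P \<gamma>) K \<and> S \<in> insert V_maps ?\<B>}"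
  have U_top: "U_top = topology_generated_by (insert U_maps ?\<D>)"
    by (rule C_alpha_topology_generated[OF V_top Hausdorff_V_top ns[symmetric]])
  have UV_open: "openin UV_top UV_maps" using openin_topspace[of UV_top] by simp
  show "continuous_map UV_top U_top (vee n m U V)"
    unfolding U_top
  proof (rule continuous_on_generated_topo)
    show "vee n m U V ` topspace UV_top \<subseteq> \<Union> (insert U_maps ?\<D>)"
      unfolding topspace_C_alpha_topology using vee_in_U_maps by blast
    fix S assume S: "S \<in> insert U_maps ?\<D>"
    \<comment> \<open>The set \<open>V_maps\<close> belongs to the subbasis of \<open>V_top\<close>,
      which accounts for the second kind of test. It is satisfied by every curried map, since its
      extensions take values in \<open>V_maps\<close>.\<close>
    consider "S = U_maps"
      | P \<gamma> K where "S = {h \<in> U_maps. ?dd P \<gamma> h ` K \<subseteq> V_maps}" "U_index P \<gamma>"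
        "compactin (node_space n P \<gamma>) K"
      | P \<gamma> K Q \<delta> L W where
        "S = {h \<in> U_maps. ?dd P \<gamma> h ` K \<subseteq> {g \<in> V_maps. dd_extension smul E m Q \<delta> g ` L \<subseteq> W}}"
        "U_index P \<gamma>" "compactin (node_space n P \<gamma>) K"
        "V_index Q \<delta>" "compactin (node_space m Q \<delta>) L" "openin E W"
    proof (cases "S = U_maps")
      case False
      have "S \<in> ?\<D>" using S False by (simp only: insert_iff simp_thms)
      then obtain P \<gamma> K R where SR: "S = {h \<in> U_maps. ?dd P \<gamma> h ` K \<subseteq> R}"
        and P: "U_index P \<gamma>" and K: "compactin (node_space n P \<gamma>) K" and R: "R \<in> insert V_maps ?\<B>"
        unfolding mem_Collect_eq by (elim exE conjE) simp
      show ?thesis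
      proof (cases "R = V_maps")
        case True
        show ?thesis using that(2)[OF SR[unfolded True] P K] .
      next
        case False
        have "R \<in> ?\<B>" using R False by (simp only: insert_iff simp_thms)
        then obtain Q \<delta> L W where RW: "R = {g \<in> V_maps. dd_extension smul E m Q \<delta> g ` L \<subseteq> W}"
          and Q: "V_index Q \<delta>" and L: "compactin (node_space m Q \<delta>) L" and W: "openin E W"
          unfolding mem_Collect_eq by (elim exE conjE) simp
        show ?thesis using that(3)[OF SR[unfolded RW] P K Q L W] .
      qed
    qed (rule that(1))
    then show "openin UV_top (vee n m U V -` S \<inter> topspace UV_top)"
      unfolding topspace_C_alpha_topology
    proof cases
      case 1
      then have "vee n m U V -` S \<inter> UV_maps = UV_maps" using vee_in_U_maps by blast
      then show "openin UV_top (vee n m U V -` S \<inter> UV_maps)" using UV_open by simp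
    next
      case 2
      have "x \<in> topspace (node_space n P \<gamma>)" if "x \<in> K" for x
        using compactin_subset_topspace[OF 2(3)] that by (rule subsetD)
      then have "vee n m U V f \<in> S" if "f \<in> UV_maps" for f
        using vee_in_U_maps[OF that] dd_extension_vee_in_V_maps[OF that 2(2)]
        unfolding 2(1) by (simp add: image_subset_iff)
      then have "vee n m U V -` S \<inter> UV_maps = UV_maps" by blast
      then show "openin UV_top (vee n m U V -` S \<inter> UV_maps)" using UV_open by simp
    next
      case 3
      have "vee n m U V f \<in> S \<longleftrightarrow> (\<forall>x\<in>K. \<forall>y\<in>L. ext f P Q \<gamma> \<delta> (join_nodes n m \<gamma> \<delta> x y) \<in> W)"
        if "f \<in> UV_maps" for f
        unfolding 3(1) by (rule vee_box[OF that 3(2,4,3,5)])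
      then have "vee n m U V -` S \<inter> UV_maps = box_maps P Q \<gamma> \<delta> K L W" by auto
      then show "openin UV_top (vee n m U V -` S \<inter> UV_maps)"
        unfolding UV_top_generated using box_subbasisI[OF 3(2,4,3,5,6)]
        by (intro topology_generated_by_Basis) simp
    qed
  qed
  fix S assume "S \<in> box_subbasis"
  then obtain P Q \<gamma> \<delta> K L W where S: "S = box_maps P Q \<gamma> \<delta> K L W" and P: "U_index P \<gamma>" and Q: "V_index Q \<delta>"
    and K: "compactin (node_space n P \<gamma>) K" and L: "compactin (node_space m Q \<delta>) L" and W: "openin E W"
    by (rule box_subbasisE)
  let ?G = "{g \<in> V_maps. dd_extension smul E m Q \<delta> g ` L \<subseteq> W}"
  let ?T = "{h \<in> U_maps. ?dd P \<gamma> h ` K \<subseteq> ?G}"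
  have "?G \<in> ?\<B>" using Q L W by (intro CollectI exI conjI) (rule refl, auto)
  then have "?T \<in> ?\<D>" using P K by (intro CollectI exI conjI) (rule refl, auto)
  then have "openin U_top ?T" unfolding U_top by (intro topology_generated_by_Basis insertI2)
  moreover have "S = {f \<in> UV_maps. vee n m U V f \<in> ?T}"
    unfolding S by (rule Collect_cong, rule conj_cong[OF refl], rule sym, rule vee_box[OF _ P Q K L])
  ultimately show "\<exists>T. openin U_top T \<and> S = {f \<in> UV_maps. vee n m U V f \<in> T}" by blast
qed

lemma homeomorphic_map_vee:
  assumes "metrizable_space (euclidean :: 'k topology)"
  shows "homeomorphic_map UV_top U_top (vee n m U V)"
proof -
  have "vee n m U V ` UV_maps = U_maps"
    using vee_in_U_maps vee_surjective[OF assms] by (auto simp: image_iff)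
  then have "subtopology U_top (vee n m U V ` topspace UV_top) = U_top"
    by (metis subtopology_topspace topspace_C_alpha_topology)
  then show ?thesis using embedding_map_vee unfolding embedding_map_def by simp
qed

end

theorem theoremD:
  fixes smul :: "'k::topological_field \<Rightarrow> 'e::ab_group_add \<Rightarrow> 'e"
    and E :: "'e topology"
    and n m :: nat
    and U V :: "(nat \<Rightarrow> 'k) set"
    and ns ms :: "nat list"
    and \<alpha> \<beta> :: "enat list"
  assumes "topological_vector_space smul E"
    and "n \<ge> 1" and "m \<ge> 1"
    and "locally_cartesian n U" and "locally_cartesian m V"
    and "\<forall>d\<in>set ns. d \<ge> 1" and "sum_list ns = n"
    and "\<forall>d\<in>set ms. d \<ge> 1" and "sum_list ms = m"
    and "length \<alpha> = length ns" and "length \<beta> = length ms"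
  shows "(\<forall>f \<in> C_alpha smul E (ns @ ms) (join_product n m U V) (\<alpha> @ \<beta>).
            (\<forall>x\<in>U. slice n m V f x \<in> C_alpha smul E ms V \<beta>) \<and>
            vee n m U V f \<in> C_alpha (fun_scale smul) (C_alpha_topology smul E ms V \<beta>) ns U \<alpha>) \<and>
         linear_map_between
           (fun_scale smul)
           (C_alpha smul E (ns @ ms) (join_product n m U V) (\<alpha> @ \<beta>))
           (fun_scale (fun_scale smul))
           (C_alpha (fun_scale smul) (C_alpha_topology smul E ms V \<beta>) ns U \<alpha>)
           (vee n m U V) \<and>
         embedding_map
           (C_alpha_topology smul E (ns @ ms) (join_product n m U V) (\<alpha> @ \<beta>))
           (C_alpha_topology (fun_scale smul) (C_alpha_topology smul E ms V \<beta>) ns U \<alpha>)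
           (vee n m U V) \<and>
         (metrizable_space (euclidean :: 'k topology) \<longrightarrow>
            homeomorphic_map
              (C_alpha_topology smul E (ns @ ms) (join_product n m U V) (\<alpha> @ \<beta>))
              (C_alpha_topology (fun_scale smul) (C_alpha_topology smul E ms V \<beta>) ns U \<alpha>)
              (vee n m U V))"
proof -
  interpret exponential_law smul E n m U V ns ms \<alpha> \<beta>
    using assms by (intro exponential_law.intro exponential_law_axioms.intro)
  show ?thesis
    using slice_in_V_maps vee_in_U_maps linear_vee embedding_map_vee homeomorphic_map_vee by blast
qed

end
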